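(* Let $\mathfrak{g}$ be a finite-dimensional Lie algebra over $\mathbb{C}$ which is a semidirect product $\mathfrak{g}=\mathfrak{p}\ltimes\mathfrak{n}$ of a subalgebra $\mathfrak{p}$ and a nilpotent ideal $\mathfrak{n}$. Assume that the adjoint action of $\mathfrak{p}$ on $\mathfrak{n}$ is faithful, i.e. for every nonzero $z\in\mathfrak{p}$ there exists $x\in\mathfrak{n}$ with $[z,x]\neq 0$. Let $k$ be the minimal positive integer such that all the commutators $[\dots[[x_1,x_2],x_3],\dots,x_k]$ with $x_1,\dots,x_k\in\mathfrak{n}$ are equal to $0$. Let $U(\mathfrak{n})$ be the universal enveloping algebra of $\mathfrak{n}$, with the action of $\mathfrak{g}$ described in the context, and let $I\subset U(\mathfrak{n})$ be the linear span of all products $x_1x_2\cdots x_N$ with $N>k+2$ and $x_1,\dots,x_N\in\mathfrak{n}$. Then $I$ is a $\mathfrak{g}$-submodule of $U(\mathfrak{n})$, and the quotient $U(\mathfrak{n})/I$ is a finite-dimensional faithful $\mathfrak{g}$-module.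
   Context: The action of $\mathfrak{g}=\mathfrak{p}\ltimes\mathfrak{n}$ on $U(\mathfrak{n})$ is defined as follows. An element $x\in\mathfrak{n}$ acts by left multiplication $u\mapsto xu$. An element $z\in\mathfrak{p}$ acts by the derivation $d_z$ of the associative algebra $U(\mathfrak{n})$ extending $x\mapsto[z,x]$ on $\mathfrak{n}$, that is, $d_z(1)=0$ and $d_z(x_1x_2\cdots x_l)=[z,x_1]x_2\cdots x_l+x_1[z,x_2]x_3\cdots x_l+\dots+x_1\cdots x_{l-1}[z,x_l]$ for $x_1,\dots,x_l\in\mathfrak{n}$. Together these define a representation of the Lie algebra $\mathfrak{g}$ on $U(\mathfrak{n})$. For $k=1$ the commutator in the definition of $k$ is understood as $x_1$ itself. A $\mathfrak{g}$-module is faithful if only $0\in\mathfrak{g}$ acts by the zero operator. *)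

theory Defs
  imports Complex_Main "HOL-Library.Poly_Mapping" "HOL-Algebra.Module" "HOL-Algebra.QuotRing"
begin

section \<open>Complex Lie algebras\<close>

locale lie_algebra = vector_space scale
  for scale :: "complex \<Rightarrow> 'g::ab_group_add \<Rightarrow> 'g" (infixr \<open>*s\<close> 75) +
  fixes bracket :: "'g \<Rightarrow> 'g \<Rightarrow> 'g"
  assumes bracket_add_left: "bracket (x + y) z = bracket x z + bracket y z"
    and bracket_add_right: "bracket x (y + z) = bracket x y + bracket x z"
    and bracket_scale_left: "bracket (c *s x) y = c *s bracket x y"
    and bracket_scale_right: "bracket x (c *s y) = c *s bracket x y"
    and bracket_self: "bracket x x = 0"
    and jacobi: "bracket x (bracket y z) + bracket y (bracket z x) + bracket z (bracket x y) = 0"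
begin

definition lie_subalgebra :: "'g set \<Rightarrow> bool" where
  "lie_subalgebra h \<longleftrightarrow> subspace h \<and> (\<forall>x\<in>h. \<forall>y\<in>h. bracket x y \<in> h)"

definition lie_ideal :: "'g set \<Rightarrow> bool" where
  "lie_ideal h \<longleftrightarrow> subspace h \<and> (\<forall>x. \<forall>y\<in>h. bracket x y \<in> h)"

primrec lower_central_series :: "'g set \<Rightarrow> nat \<Rightarrow> 'g set" where
  "lower_central_series h 0 = h"
| "lower_central_series h (Suc i) =
     span {bracket x y | x y. x \<in> lower_central_series h i \<and> y \<in> h}"

definition lie_nilpotent :: "'g set \<Rightarrow> bool" where
  "lie_nilpotent h \<longleftrightarrow> (\<exists>i. lower_central_series h i = {0})"

definition semidirect_product :: "'g set \<Rightarrow> 'g set \<Rightarrow> bool" where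
  "semidirect_product p n \<longleftrightarrow> lie_subalgebra p \<and> lie_ideal n \<and>
     p \<inter> n = {0} \<and> (\<forall>y. \<exists>z\<in>p. \<exists>x\<in>n. y = z + x)"

end

text \<open>The commutator \<open>[\<dots>[[x\<^sub>1,x\<^sub>2],x\<^sub>3],\<dots>,x\<^sub>k]\<close>, which is \<open>x\<^sub>1\<close> for \<open>k = 1\<close>.
  The value on the empty list is irrelevant.\<close>

fun left_commutator :: "('g \<Rightarrow> 'g \<Rightarrow> 'g) \<Rightarrow> 'g::zero list \<Rightarrow> 'g" where
  "left_commutator bracket [] = 0"
| "left_commutator bracket (x # xs) = foldl bracket x xs"


section \<open>Complex vector spaces with a carrier, and Lie algebra modules\<close>

text \<open>Vector spaces over \<open>\<complex>\<close> with an explicit carrier are HOL-Algebra modules over the following ring.\<close>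

definition complex_field :: "complex ring" where
  "complex_field = \<lparr>carrier = UNIV, mult = (*), one = 1, zero = 0, add = (+)\<rparr>"

definition lin_span :: "(complex, 'v) module \<Rightarrow> 'v set \<Rightarrow> 'v set" where
  "lin_span M S = \<Inter>{W. submodule W complex_field M \<and> S \<subseteq> W}"

definition fin_dim :: "(complex, 'v) module \<Rightarrow> bool" where
  "fin_dim M \<longleftrightarrow> (\<exists>B. finite B \<and> B \<subseteq> carrier M \<and> lin_span M B = carrier M)"

text \<open>The map on cosets of \<open>H\<close> induced by a map \<open>T\<close> that respects them:
  \<open>x + H\<close> is sent to \<open>T x + H\<close>, as in the library's \<^const>\<open>rcoset_mult\<close>.\<close>

definition coset_map :: "('v, 'm) ring_scheme \<Rightarrow> 'v set \<Rightarrow> ('v \<Rightarrow> 'v) \<Rightarrow> 'v set \<Rightarrow> 'v set" where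
  "coset_map M H T C = (\<Union>x\<in>C. H +>\<^bsub>M\<^esub> T x)"

text \<open>A record of type \<^typ>\<open>(complex, 'v) module\<close> has multiplicative fields, which play no role
  for a vector space.\<close>

definition quotient_space :: "(complex, 'v) module \<Rightarrow> 'v set \<Rightarrow> (complex, 'v set) module" where
  "quotient_space M W =
    \<lparr>carrier = a_rcosets\<^bsub>M\<^esub> W, mult = undefined, one = undefined, zero = W, add = set_add M,
     smult = (\<lambda>c. coset_map M W (smult M c))\<rparr>"

definition lie_module :: "(complex \<Rightarrow> 'g::ab_group_add \<Rightarrow> 'g) \<Rightarrow> ('g \<Rightarrow> 'g \<Rightarrow> 'g) \<Rightarrow>
    (complex, 'v) module \<Rightarrow> ('g \<Rightarrow> 'v \<Rightarrow> 'v) \<Rightarrow> bool" where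
  "lie_module scale bracket M act \<longleftrightarrow>
     lie_algebra scale bracket \<and> Module.module complex_field M \<and>
     (\<forall>x. \<forall>v\<in>carrier M. act x v \<in> carrier M) \<and>
     (\<forall>x. \<forall>v\<in>carrier M. \<forall>w\<in>carrier M. act x (v \<oplus>\<^bsub>M\<^esub> w) = act x v \<oplus>\<^bsub>M\<^esub> act x w) \<and>
     (\<forall>x c. \<forall>v\<in>carrier M. act x (c \<odot>\<^bsub>M\<^esub> v) = c \<odot>\<^bsub>M\<^esub> act x v) \<and>
     (\<forall>x y. \<forall>v\<in>carrier M. act (x + y) v = act x v \<oplus>\<^bsub>M\<^esub> act y v) \<and>
     (\<forall>c x. \<forall>v\<in>carrier M. act (scale c x) v = c \<odot>\<^bsub>M\<^esub> act x v) \<and>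
     (\<forall>x y. \<forall>v\<in>carrier M. act (bracket x y) v = act x (act y v) \<ominus>\<^bsub>M\<^esub> act y (act x v))"

definition lie_submodule :: "(complex \<Rightarrow> 'g::ab_group_add \<Rightarrow> 'g) \<Rightarrow> ('g \<Rightarrow> 'g \<Rightarrow> 'g) \<Rightarrow>
    (complex, 'v) module \<Rightarrow> ('g \<Rightarrow> 'v \<Rightarrow> 'v) \<Rightarrow> 'v set \<Rightarrow> bool" where
  "lie_submodule scale bracket M act W \<longleftrightarrow>
     lie_module scale bracket M act \<and> submodule W complex_field M \<and> (\<forall>x. \<forall>w\<in>W. act x w \<in> W)"

definition faithful_action :: "(complex, 'v) module \<Rightarrow> ('g::zero \<Rightarrow> 'v \<Rightarrow> 'v) \<Rightarrow> bool" where
  "faithful_action M act \<longleftrightarrow> (\<forall>x. (\<forall>v\<in>carrier M. act x v = \<zero>\<^bsub>M\<^esub>) \<longrightarrow> x = 0)"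


section \<open>The universal enveloping algebra\<close>

text \<open>With concatenation as addition on lists, \<^typ>\<open>'a list \<Rightarrow>\<^sub>0 complex\<close> carries the convolution
  product, i.e. it is the free associative unital algebra on \<^typ>\<open>'a\<close>.\<close>

instantiation list :: (type) monoid_add
begin

definition zero_list :: "'a list" where "zero_list = []"

definition plus_list :: "'a list \<Rightarrow> 'a list \<Rightarrow> 'a list" where "plus_list = (@)"

instance
  by standard (simp_all add: zero_list_def plus_list_def)

end

definition free_algebra :: "'g set \<Rightarrow> (complex, 'g list \<Rightarrow>\<^sub>0 complex) module" where
  "free_algebra n =
    \<lparr>carrier = {f. Poly_Mapping.keys f \<subseteq> lists n}, mult = (*), one = 1, zero = 0, add = (+),
     smult = (\<lambda>c. Poly_Mapping.map ((*) c))\<rparr>"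

abbreviation word :: "'g list \<Rightarrow> 'g list \<Rightarrow>\<^sub>0 complex" where
  "word w \<equiv> Poly_Mapping.single w 1"

text \<open>\<open>U(n)\<close> is the tensor algebra of \<open>n\<close> modulo \<open>x \<otimes> y - y \<otimes> x - [x,y]\<close>; the first two families
  of relations turn the free algebra on the set \<open>n\<close> into the tensor algebra of the vector space.\<close>

definition enveloping_relations ::
    "(complex \<Rightarrow> 'g::ab_group_add \<Rightarrow> 'g) \<Rightarrow> ('g \<Rightarrow> 'g \<Rightarrow> 'g) \<Rightarrow> 'g set \<Rightarrow> ('g list \<Rightarrow>\<^sub>0 complex) set" where
  "enveloping_relations scale bracket n =
     {word [x + y] - word [x] - word [y] | x y. x \<in> n \<and> y \<in> n} \<union>
     {word [scale c x] - Poly_Mapping.single [x] c | c x. x \<in> n} \<union>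
     {word [x] * word [y] - word [y] * word [x] - word [bracket x y] | x y. x \<in> n \<and> y \<in> n}"

definition enveloping_ideal ::
    "(complex \<Rightarrow> 'g::ab_group_add \<Rightarrow> 'g) \<Rightarrow> ('g \<Rightarrow> 'g \<Rightarrow> 'g) \<Rightarrow> 'g set \<Rightarrow> ('g list \<Rightarrow>\<^sub>0 complex) set" where
  "enveloping_ideal scale bracket n =
     genideal (free_algebra n) (enveloping_relations scale bracket n)"

definition enveloping_algebra ::
    "(complex \<Rightarrow> 'g::ab_group_add \<Rightarrow> 'g) \<Rightarrow> ('g \<Rightarrow> 'g \<Rightarrow> 'g) \<Rightarrow> 'g set \<Rightarrow>
      (complex, ('g list \<Rightarrow>\<^sub>0 complex) set) module" where
  "enveloping_algebra scale bracket n =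
    (let F = free_algebra n; J = enveloping_ideal scale bracket n in
     ring.extend (F Quot J) (module.fields (\<lambda>c. coset_map F J (smult F c))))"

definition env_incl ::
    "(complex \<Rightarrow> 'g::ab_group_add \<Rightarrow> 'g) \<Rightarrow> ('g \<Rightarrow> 'g \<Rightarrow> 'g) \<Rightarrow> 'g set \<Rightarrow> 'g \<Rightarrow> ('g list \<Rightarrow>\<^sub>0 complex) set" where
  "env_incl scale bracket n x = enveloping_ideal scale bracket n +>\<^bsub>free_algebra n\<^esub> word [x]"

text \<open>The product \<open>x\<^sub>1 x\<^sub>2 \<cdots> x\<^sub>l\<close> in \<open>U(n)\<close>.\<close>

definition env_prod ::
    "(complex \<Rightarrow> 'g::ab_group_add \<Rightarrow> 'g) \<Rightarrow> ('g \<Rightarrow> 'g \<Rightarrow> 'g) \<Rightarrow> 'g set \<Rightarrow> 'g list \<Rightarrow>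
      ('g list \<Rightarrow>\<^sub>0 complex) set" where
  "env_prod scale bracket n xs =
    (let U = enveloping_algebra scale bracket n in
     foldr (\<lambda>x u. env_incl scale bracket n x \<otimes>\<^bsub>U\<^esub> u) xs \<one>\<^bsub>U\<^esub>)"

definition long_products_span ::
    "(complex \<Rightarrow> 'g::ab_group_add \<Rightarrow> 'g) \<Rightarrow> ('g \<Rightarrow> 'g \<Rightarrow> 'g) \<Rightarrow> 'g set \<Rightarrow> nat \<Rightarrow>
      ('g list \<Rightarrow>\<^sub>0 complex) set set" where
  "long_products_span scale bracket n m =
     lin_span (enveloping_algebra scale bracket n)
       {env_prod scale bracket n xs | xs. set xs \<subseteq> n \<and> length xs > m}"


section \<open>The action of \<open>p \<ltimes> n\<close> on \<open>U(n)\<close>\<close>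

text \<open>The derivation of the free algebra with
  \<open>x\<^sub>1 \<cdots> x\<^sub>l \<mapsto> \<Sum>\<^sub>i x\<^sub>1 \<cdots> [z,x\<^sub>i] \<cdots> x\<^sub>l\<close>; it preserves the enveloping ideal when \<open>z\<close> normalises \<open>n\<close>.\<close>

definition free_derivation ::
    "('g \<Rightarrow> 'g \<Rightarrow> 'g) \<Rightarrow> 'g \<Rightarrow> ('g list \<Rightarrow>\<^sub>0 complex) \<Rightarrow> ('g list \<Rightarrow>\<^sub>0 complex)" where
  "free_derivation bracket z f =
     (\<Sum>w\<in>Poly_Mapping.keys f. \<Sum>i<length w.
        Poly_Mapping.single (w[i := bracket z (w ! i)]) (Poly_Mapping.lookup f w))"

definition env_derivation ::
    "(complex \<Rightarrow> 'g::ab_group_add \<Rightarrow> 'g) \<Rightarrow> ('g \<Rightarrow> 'g \<Rightarrow> 'g) \<Rightarrow> 'g set \<Rightarrow> 'g \<Rightarrow>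
      ('g list \<Rightarrow>\<^sub>0 complex) set \<Rightarrow> ('g list \<Rightarrow>\<^sub>0 complex) set" where
  "env_derivation scale bracket n z =
     coset_map (free_algebra n) (enveloping_ideal scale bracket n) (free_derivation bracket z)"

text \<open>The component in \<open>p\<close> along \<open>n\<close>.\<close>

definition proj_compl :: "'g::ab_group_add set \<Rightarrow> 'g set \<Rightarrow> 'g \<Rightarrow> 'g" where
  "proj_compl p n y = (THE z. z \<in> p \<and> y - z \<in> n)"

definition env_action ::
    "(complex \<Rightarrow> 'g::ab_group_add \<Rightarrow> 'g) \<Rightarrow> ('g \<Rightarrow> 'g \<Rightarrow> 'g) \<Rightarrow> 'g set \<Rightarrow> 'g set \<Rightarrow> 'g \<Rightarrow>
      ('g list \<Rightarrow>\<^sub>0 complex) set \<Rightarrow> ('g list \<Rightarrow>\<^sub>0 complex) set" where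
  "env_action scale bracket p n y u =
    (let U = enveloping_algebra scale bracket n; z = proj_compl p n y in
     env_derivation scale bracket n z u \<oplus>\<^bsub>U\<^esub> (env_incl scale bracket n (y - z) \<otimes>\<^bsub>U\<^esub> u))"


section \<open>The derivations are well defined\<close>

lemma free_derivation_superset:
  assumes "finite A" "Poly_Mapping.keys f \<subseteq> A"
  shows "free_derivation br z f = (\<Sum>w\<in>A. \<Sum>i<length w. Poly_Mapping.single (w[i := br z (w ! i)]) (Poly_Mapping.lookup f w))"
  unfolding free_derivation_def
  by (rule sum.mono_neutral_left) (use assms in \<open>auto simp: in_keys_iff\<close>)

lemma free_derivation_add: "free_derivation br z (f + g) = free_derivation br z f + free_derivation br z g"
  unfolding free_derivation_superset[of "Poly_Mapping.keys f \<union> Poly_Mapping.keys g" "f+g", simplified, OF Poly_Mapping.keys_add]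
    free_derivation_superset[of "Poly_Mapping.keys f \<union> Poly_Mapping.keys g" "f", simplified]
    free_derivation_superset[of "Poly_Mapping.keys f \<union> Poly_Mapping.keys g" "g", simplified]
  by (simp add: lookup_add single_add sum.distrib)

lemma free_derivation_single: "free_derivation br z (Poly_Mapping.single w c) = (\<Sum>i<length w. Poly_Mapping.single (w[i := br z (w ! i)]) c)"
  by (subst free_derivation_superset[of "{w}"]) auto

lemma free_derivation_zero [simp]: "free_derivation br z 0 = 0" by (simp add: free_derivation_def)
lemma free_derivation_uminus: "free_derivation br z (- f) = - free_derivation br z f"
  using free_derivation_add[of br z f "-f"] by (simp add: eq_neg_iff_add_eq_0 add.commute)
lemma free_derivation_diff: "free_derivation br z (f - g) = free_derivation br z f - free_derivation br z g"
  using free_derivation_add[of br z f "-g"] by (simp add: free_derivation_uminus)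

lemma poly_mapping_single_induct: 
  assumes "\<And>w c. P (Poly_Mapping.single w c)" "\<And>f g. P f \<Longrightarrow> P g \<Longrightarrow> P (f + g)"
  shows "P (f :: 'a \<Rightarrow>\<^sub>0 complex)"
proof -
  have "P 0" using assms(1)[of undefined 0] by simp
  then show ?thesis
  proof (induct f rule: update_induct)
    case (update f a b)
    have "Poly_Mapping.update a b f = f + Poly_Mapping.single a b"
      using update by (intro poly_mapping_eqI) (auto simp: lookup_update lookup_add lookup_single when_def in_keys_iff)
    then show ?case using assms update by simp
  qed (use assms in auto)
qed

lemma sum_lessThan_add: "(\<Sum>i<m+(n::nat). h i) = (\<Sum>i<m. h i) + (\<Sum>i<n. h (m+i) :: 'b::comm_monoid_add)"
  by (induct n) (simp_all add: ac_simps)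

lemma free_derivation_mult_single: "free_derivation br z (Poly_Mapping.single v a * Poly_Mapping.single w b)
  = free_derivation br z (Poly_Mapping.single v a) * Poly_Mapping.single w b + Poly_Mapping.single v a * free_derivation br z (Poly_Mapping.single w b)"
proof -
  have "(\<Sum>i<length v + length w. Poly_Mapping.single ((v @ w)[i := br z ((v @ w) ! i)]) (a * b)) =
   (\<Sum>i<length v. Poly_Mapping.single ((v @ w)[i := br z ((v @ w) ! i)]) (a * b)) +
   (\<Sum>i<length w. Poly_Mapping.single ((v @ w)[length v + i := br z ((v @ w) ! (length v + i))]) (a * b))"
    by (rule sum_lessThan_add)
  then show ?thesis
    by (simp add: free_derivation_single mult_single plus_list_def sum_distrib_left sum_distrib_right list_update_append nth_append)
qed

lemma free_derivation_mult: "free_derivation br z (f * g) = free_derivation br z f * g + f * free_derivation br z g"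
proof (induct f rule: poly_mapping_single_induct)
  case (1 v a) show ?case
    by (induct g rule: poly_mapping_single_induct) (simp_all add: free_derivation_mult_single distrib_left free_derivation_add ac_simps)
qed (simp_all add: distrib_right free_derivation_add ac_simps)

lemma ring_free_algebra: "ring (free_algebra n)"
proof (rule ringI)
  have keys: "Poly_Mapping.keys (f + g) \<subseteq> lists n" "Poly_Mapping.keys (f * g) \<subseteq> lists n"
    if "Poly_Mapping.keys f \<subseteq> lists n" "Poly_Mapping.keys g \<subseteq> lists n" for f g :: "'a list \<Rightarrow>\<^sub>0 complex"
  proof -
    show "Poly_Mapping.keys (f + g) \<subseteq> lists n"
      using that Poly_Mapping.keys_add[of f g] by blast
    have "a + b \<in> lists n" if "a \<in> lists n" "b \<in> lists n" for a b
      using that by (simp add: plus_list_def)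
    with that show "Poly_Mapping.keys (f * g) \<subseteq> lists n"
      using keys_mult[of f g] by blast
  qed
  show "abelian_group (free_algebra n)"
  proof (rule abelian_groupI)
    fix f assume "f \<in> carrier (free_algebra n)"
    then show "\<exists>g\<in>carrier (free_algebra n). g \<oplus>\<^bsub>free_algebra n\<^esub> f = \<zero>\<^bsub>free_algebra n\<^esub>"
      by (intro bexI[of _ "- f"]) (simp_all add: free_algebra_def)
  qed (simp_all add: free_algebra_def keys ac_simps)
  show "Group.monoid (free_algebra n)"
    by (rule monoidI) (simp_all add: free_algebra_def keys mult.assoc, simp add: zero_list_def)
qed (simp_all add: free_algebra_def distrib_left distrib_right)

lemma free_derivation_closed: assumes "\<And>x. x \<in> n \<Longrightarrow> br z x \<in> n" "f \<in> carrier (free_algebra n)"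
  shows "free_derivation br z f \<in> carrier (free_algebra n)"
proof -
  have "Poly_Mapping.keys (free_derivation br z f) \<subseteq> (\<Union>w\<in>Poly_Mapping.keys f. \<Union>i<length w. {w[i := br z (w ! i)]})"
    unfolding free_derivation_def
    by (rule order_trans[OF Poly_Mapping.keys_sum UN_mono], rule order_refl, rule order_trans[OF Poly_Mapping.keys_sum UN_mono]) auto
  also have "\<dots> \<subseteq> lists n"
  proof (clarify intro!: in_listsI)
    fix w i x assume w: "w \<in> Poly_Mapping.keys f" "i < length w" and x: "x \<in> set (w[i := br z (w ! i)])"
    have sw: "set w \<subseteq> n" using w assms(2) by (auto simp: free_algebra_def)
    then have "br z (w ! i) \<in> n" using w(2) by (intro assms(1)) auto
    with sw x show "x \<in> n" using set_update_subset_insert[of w i "br z (w ! i)"] by blast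
  qed
  finally show ?thesis by (simp add: free_algebra_def)
qed

lemma uminus_free_algebra: "f \<in> carrier (free_algebra n) \<Longrightarrow> \<ominus>\<^bsub>free_algebra n\<^esub> f = - f"
proof -
  interpret ring "free_algebra n" by (rule ring_free_algebra)
  assume f: "f \<in> carrier (free_algebra n)"
  then have "- f \<in> carrier (free_algebra n)" by (simp add: free_algebra_def)
  with f show ?thesis by (intro minus_equality) (simp_all add: free_algebra_def)
qed

context lie_algebra begin

lemma enveloping_relations_subset:
  assumes "lie_ideal n"
  shows "enveloping_relations scale bracket n \<subseteq> carrier (free_algebra n)"
proof -
  have diff: "f - g \<in> carrier (free_algebra n)"
    if "f \<in> carrier (free_algebra n)" "g \<in> carrier (free_algebra n)" for f g
    using that Poly_Mapping.keys_diff[of f g] by (auto simp: free_algebra_def)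
  have single: "Poly_Mapping.single w c \<in> carrier (free_algebra n)" if "set w \<subseteq> n" for w c
    using that by (auto simp: free_algebra_def)
  have word_mult: "word [x] * word [y] = word [x, y]" for x y :: 'b
    by (simp add: mult_single plus_list_def)
  have closed: "x + y \<in> n" "scale c x \<in> n" "bracket x y \<in> n" if "x \<in> n" "y \<in> n" for x y c
    using assms that by (simp_all add: lie_ideal_def subspace_add subspace_scale)
  show ?thesis
  proof
    fix r assume "r \<in> enveloping_relations scale bracket n"
    then consider x y where "x \<in> n" "y \<in> n" "r = word [x + y] - word [x] - word [y]"
      | c x where "x \<in> n" "r = word [scale c x] - Poly_Mapping.single [x] c"
      | x y where "x \<in> n" "y \<in> n" "r = word [x] * word [y] - word [y] * word [x] - word [bracket x y]"
      unfolding enveloping_relations_def by blast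
    then show "r \<in> carrier (free_algebra n)"
    proof cases
      case 1
      show ?thesis unfolding 1(3) by (intro diff single) (use 1 closed in auto)
    next
      case 2
      show ?thesis unfolding 2(2) by (intro diff single) (use 2 closed in auto)
    next
      case 3
      show ?thesis unfolding 3(3) word_mult by (intro diff single) (use 3 closed in auto)
    qed
  qed
qed

lemma ideal_enveloping_ideal: "lie_ideal n \<Longrightarrow> ideal (enveloping_ideal scale bracket n) (free_algebra n)"
  unfolding enveloping_ideal_def by (intro ring.genideal_ideal ring_free_algebra enveloping_relations_subset)

lemma free_derivation_enveloping_ideal: assumes n: "lie_ideal n" and f: "f \<in> enveloping_ideal scale bracket n"
  shows "free_derivation bracket z f \<in> enveloping_ideal scale bracket n"
proof -
  let ?J = "enveloping_ideal scale bracket n" and ?F = "free_algebra n"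
  let ?K = "{f \<in> ?J. free_derivation bracket z f \<in> ?J}"
  interpret J: ideal ?J ?F by (rule ideal_enveloping_ideal[OF n])
  have J: "?J \<subseteq> carrier ?F" by (rule J.a_subset)
  have add: "a + b \<in> ?J" if "a \<in> ?J" "b \<in> ?J" for a b using additive_subgroup.a_closed[OF J.is_additive_subgroup that] by (simp add: free_algebra_def)
  have neg: "- a \<in> ?J" if "a \<in> ?J" for a using additive_subgroup.a_inv_closed[OF J.is_additive_subgroup that] that J by (auto simp: uminus_free_algebra)
  have l: "a * b \<in> ?J" "b * a \<in> ?J" if "a \<in> ?J" "b \<in> carrier ?F" for a b
    using J.I_l_closed[OF that] J.I_r_closed[OF that] by (auto simp: free_algebra_def)
  have z: "0 \<in> ?J" using additive_subgroup.zero_closed[OF J.is_additive_subgroup] by (simp add: free_algebra_def)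
  have br: "bracket z x \<in> n" if "x \<in> n" for x using n that by (auto simp: lie_ideal_def)
  have D: "free_derivation bracket z b \<in> carrier ?F" if "b \<in> carrier ?F" for b
    by (intro free_derivation_closed br that)
  have K: "ideal ?K ?F"
  proof (rule idealI)
    show "subgroup ?K (add_monoid ?F)"
    proof (rule group.subgroupI[OF abelian_group.a_group])
      show "abelian_group ?F" using ring_free_algebra ring.is_abelian_group by blast
      show "?K \<noteq> {}" using z free_derivation_zero by fastforce
      show "?K \<subseteq> carrier (add_monoid ?F)" using J by auto
      show "inv\<^bsub>add_monoid ?F\<^esub> a \<in> ?K" if "a \<in> ?K" for a
      proof -
        have "inv\<^bsub>add_monoid ?F\<^esub> a = - a" using that J uminus_free_algebra[of a n] by (auto simp: a_inv_def)
        then show ?thesis using that by (simp add: neg free_derivation_uminus)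
      qed
    qed (auto simp: free_algebra_def add free_derivation_add)
    show "x \<otimes>\<^bsub>?F\<^esub> a \<in> ?K" "a \<otimes>\<^bsub>?F\<^esub> x \<in> ?K" if "a \<in> ?K" "x \<in> carrier ?F" for a x
      using l[of a x] l[of a "free_derivation bracket z x"] l[of "free_derivation bracket z a" x] D that 
      by (auto simp: free_algebra_def free_derivation_mult add)
  qed (rule ring_free_algebra)
  have "enveloping_relations scale bracket n \<subseteq> ?K"
  proof
    fix r assume r: "r \<in> enveloping_relations scale bracket n"
    have R: "enveloping_relations scale bracket n \<subseteq> ?J" unfolding enveloping_ideal_def
      by (intro ring.genideal_self ring_free_algebra enveloping_relations_subset n)
    have ad: "bracket z (x + y) = bracket z x + bracket z y" for x y by (rule bracket_add_right)
    have z0: "bracket z (bracket x y) = bracket (bracket z x) y + bracket x (bracket z y)" for x y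
    proof -
      have anti: "bracket b a = - bracket a b" for a b
        using bracket_self[of "a+b"] bracket_self[of a] bracket_self[of b] unfolding eq_neg_iff_add_eq_0 by (simp add: bracket_add_left bracket_add_right add.commute)
      have neg: "bracket a (- b) = - bracket a b" for a b using bracket_add_right[of a b "-b"] bracket_add_right[of a 0 0]
        by (simp add: eq_neg_iff_add_eq_0 add.commute)
      have 1: "bracket x (bracket z y) = - bracket x (bracket y z)"
        unfolding anti[of z y] by (rule neg)
      have 2: "bracket (bracket z x) y = - bracket y (bracket z x)" by (rule anti)
      have "bracket z (bracket x y) + (bracket x (bracket y z) + bracket y (bracket z x)) = 0"
        using jacobi[of z x y] by (simp only: add.assoc)
      then show ?thesis unfolding 1 2 eq_neg_iff_add_eq_0[symmetric] by simp
    qed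
    from r consider x y where "x \<in> n" "y \<in> n" "r = word [x + y] - word [x] - word [y]"
      | c x where "x \<in> n" "r = word [scale c x] - Poly_Mapping.single [x] c"
      | x y where "x \<in> n" "y \<in> n" "r = word [x] * word [y] - word [y] * word [x] - word [bracket x y]"
      unfolding enveloping_relations_def by blast
    then have "free_derivation bracket z r \<in> ?J"
    proof cases
      case 1
      then have "word [bracket z x + bracket z y] - word [bracket z x] - word [bracket z y] \<in> ?J"
        using br[of x] br[of y] by (intro subsetD[OF R]) (unfold enveloping_relations_def, blast)
      then show ?thesis using 1 by (simp add: free_derivation_diff free_derivation_single ad)
    next
      case 2
      then have "word [scale c (bracket z x)] - Poly_Mapping.single [bracket z x] c \<in> ?J"
        using br[of x] by (intro subsetD[OF R]) (unfold enveloping_relations_def, blast)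
      then show ?thesis using 2
        by (simp add: free_derivation_diff free_derivation_single bracket_scale_right)
    next
      case 3
      have bn: "bracket a b \<in> n" if "b \<in> n" for a b using n that by (simp add: lie_ideal_def)
      have "word [bracket z x] * word [y] - word [y] * word [bracket z x] - word [bracket (bracket z x) y] \<in> ?J"
         "word [x] * word [bracket z y] - word [bracket z y] * word [x] - word [bracket x (bracket z y)] \<in> ?J"
         "word [bracket (bracket z x) y + bracket x (bracket z y)] - word [bracket (bracket z x) y] - word [bracket x (bracket z y)] \<in> ?J"
        using 3 br[of x] br[of y] bn by (intro subsetD[OF R]; unfold enveloping_relations_def; blast)+
      note sum = add[OF add[OF this(1,2)] neg[OF this(3)]]
      have "free_derivation bracket z r =
          word [bracket z x] * word [y] + word [x] * word [bracket z y] -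
          (word [bracket z y] * word [x] + word [y] * word [bracket z x]) -
          word [bracket (bracket z x) y + bracket x (bracket z y)]"
        unfolding 3(3) free_derivation_diff free_derivation_mult
        by (simp add: free_derivation_single z0 del: mult_single)
      then show ?thesis using sum by (simp only:) (simp add: algebra_simps)
    qed
    then show "r \<in> ?K" using r R by auto
  qed
  from ring.genideal_minimal[OF ring_free_algebra K this] f show ?thesis unfolding enveloping_ideal_def by auto
qed


lemma env_derivation_coset: assumes n: "lie_ideal n" and f: "f \<in> carrier (free_algebra n)"
  shows "env_derivation scale bracket n z (enveloping_ideal scale bracket n +>\<^bsub>free_algebra n\<^esub> f)
    = enveloping_ideal scale bracket n +>\<^bsub>free_algebra n\<^esub> free_derivation bracket z f"
proof -
  let ?J = "enveloping_ideal scale bracket n" and ?F = "free_algebra n"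
  interpret J: ideal ?J ?F by (rule ideal_enveloping_ideal[OF n])
  have br: "bracket z x \<in> n" if "x \<in> n" for x using n that by (auto simp: lie_ideal_def)
  have D: "free_derivation bracket z b \<in> carrier ?F" if "b \<in> carrier ?F" for b
    by (intro free_derivation_closed br that)
  have "?J +>\<^bsub>?F\<^esub> free_derivation bracket z g = ?J +>\<^bsub>?F\<^esub> free_derivation bracket z f" if gf: "g \<in> ?J +>\<^bsub>?F\<^esub> f" for g
  proof -
    obtain j where j: "j \<in> ?J" "g = j + f" using gf unfolding a_r_coset_def' by (auto simp: free_algebra_def)
    have "free_derivation bracket z g \<in> ?J +>\<^bsub>?F\<^esub> free_derivation bracket z f"
      using free_derivation_enveloping_ideal[OF n j(1)] unfolding a_r_coset_def' by (auto simp: free_algebra_def j free_derivation_add)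
    then show ?thesis
      using J.a_repr_independence[OF _ D[OF f] additive_subgroup.a_subgroup[OF J.is_additive_subgroup]] by simp
  qed
  moreover have "f \<in> ?J +>\<^bsub>?F\<^esub> f" using f J.a_rcos_self by blast
  ultimately show ?thesis unfolding env_derivation_def coset_map_def by blast
qed

lemma env_prod_word: assumes n: "lie_ideal n" and "set xs \<subseteq> n"
  shows "env_prod scale bracket n xs = enveloping_ideal scale bracket n +>\<^bsub>free_algebra n\<^esub> word xs"
  using assms(2)
proof (induct xs)
  case Nil show ?case
    by (simp add: env_prod_def enveloping_algebra_def Let_def FactRing_def ring.defs module.defs) (simp add: free_algebra_def zero_list_def[symmetric])
next
  case (Cons x xs)
  interpret J: ideal "enveloping_ideal scale bracket n" "free_algebra n" by (rule ideal_enveloping_ideal[OF n])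
  have c: "word [x] \<in> carrier (free_algebra n)" "word xs \<in> carrier (free_algebra n)" using Cons by (auto simp: free_algebra_def)
  have m: "word [x] \<otimes>\<^bsub>free_algebra n\<^esub> word xs = word (x # xs)" by (simp add: free_algebra_def mult_single plus_list_def)
  show ?case using Cons J.rcoset_mult_add[OF c] m
    by (simp add: env_prod_def enveloping_algebra_def Let_def FactRing_def ring.defs module.defs env_incl_def)
qed

lemma env_derivation_env_prod:
  assumes "lie_ideal n" and "set xs \<subseteq> n"
  shows "env_derivation scale bracket n z (env_prod scale bracket n xs) =
    enveloping_ideal scale bracket n +>\<^bsub>free_algebra n\<^esub> (\<Sum>i<length xs. word (xs[i := bracket z (xs ! i)]))"
proof -
  have "word xs \<in> carrier (free_algebra n)" using assms by (auto simp: free_algebra_def)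
  with assms show ?thesis by (simp add: env_prod_word env_derivation_coset free_derivation_single)
qed

end

end

theory Submission
  imports Defs
begin

text \<open>If \<open>y = z + x\<close> acts by zero on \<open>U(n)/I\<close>, applying it to \<open>1\<close> gives \<open>x \<in> I\<close>, and once \<open>x = 0\<close>, applying \<open>z\<close> to
  \<open>a \<in> n\<close> gives \<open>[z,a] \<in> I\<close>. So faithfulness follows from \<open>n \<inter> I = 0\<close>, which is proved without the
  Poincare-Birkhoff-Witt theorem. Filter \<open>n\<close> by its lower central series \<open>G\<close> and \<open>U(n)\<close> by the induced weight,
  and show by induction on \<open>dim n\<close> that \<open>y \<in> n\<close> of weight at least \<open>j\<close> in \<open>U(n)\<close> vanishes if \<open>G j = 0\<close>. Let \<open>a\<close> be
  maximal with \<open>n \<subseteq> G a\<close> and choose an ideal \<open>m\<close> of codimension 1 containing \<open>n \<inter> G (a + 1)\<close>, so that \<open>n = \<complex>x + m\<close>.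
  Then \<open>n\<close> acts on \<open>U(m)\<close>, with \<open>x\<close> acting as a derivation, and an element of weight \<open>i\<close> raises weights by \<open>i\<close>;
  applying \<open>y\<close> to \<open>1\<close> shows that its component in \<open>m\<close> has weight at least \<open>j\<close> in \<open>U(m)\<close>, hence is zero. Its component
  along \<open>x\<close> is detected by \<open>U(n) \<rightarrow> U(n/m) = \<complex>[t]\<close>, since \<open>j > a\<close> forces the image to be divisible by \<open>t\<^sup>2\<close>.\<close>

section \<open>The free algebra and the enveloping ideal\<close>

text \<open>Products of words are kept as products, because the relations of \<open>U(n)\<close> and
  the Leibniz rule are matched in the form \<open>word [x] * word [y]\<close>.\<close>

declare mult_single [simp del]

lemma zero_free_algebra: "0 \<in> carrier (free_algebra n)"
  and add_free_algebra: "f \<in> carrier (free_algebra n) \<Longrightarrow> g \<in> carrier (free_algebra n) \<Longrightarrow> f + g \<in> carrier (free_algebra n)"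
  and mult_free_algebra: "f \<in> carrier (free_algebra n) \<Longrightarrow> g \<in> carrier (free_algebra n) \<Longrightarrow> f * g \<in> carrier (free_algebra n)"
  and minus_free_algebra: "f \<in> carrier (free_algebra n) \<Longrightarrow> - f \<in> carrier (free_algebra n)"
  and single_free_algebra: "set w \<subseteq> n \<Longrightarrow> Poly_Mapping.single w c \<in> carrier (free_algebra n)"
  using ring.ring_simprules(1,5)[OF ring_free_algebra, of _ n]
  by (auto simp: free_algebra_def)

lemma diff_free_algebra: "f \<in> carrier (free_algebra n) \<Longrightarrow> g \<in> carrier (free_algebra n) \<Longrightarrow> f - g \<in> carrier (free_algebra n)"
  using add_free_algebra[OF _ minus_free_algebra] by fastforce

lemmas free_algebra_closed = zero_free_algebra add_free_algebra mult_free_algebra minus_free_algebra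
  diff_free_algebra single_free_algebra

lemma free_algebra_simps [simp]:
  "f \<oplus>\<^bsub>free_algebra n\<^esub> g = f + g" "f \<otimes>\<^bsub>free_algebra n\<^esub> g = f * g" "\<zero>\<^bsub>free_algebra n\<^esub> = 0" "\<one>\<^bsub>free_algebra n\<^esub> = 1"
  by (simp_all add: free_algebra_def)

lemma single_Nil_mult_single [simp]: "Poly_Mapping.single [] c * Poly_Mapping.single w d = Poly_Mapping.single w (c * d :: complex)"
  "Poly_Mapping.single w d * Poly_Mapping.single [] c = Poly_Mapping.single w (c * d :: complex)"
  by (simp_all add: mult_single plus_list_def mult.commute)

lemma word_Nil [simp]: "word [] = 1"
  by (simp add: zero_list_def[symmetric])

lemma word_Cons: "word (x # w) = word [x] * word w"
  by (simp add: mult_single plus_list_def)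

text \<open>A scalar sits inside the free algebra as a multiple of the empty word, and as such it is
  central.\<close>

lemma single_Nil_commute: "Poly_Mapping.single [] c * f = f * Poly_Mapping.single [] (c :: complex)"
  by (induct f rule: poly_mapping_single_induct) (simp_all add: distrib_left distrib_right)

text \<open>Turns scalar multiplication into a product inside the algebra, so that ring identities
  and closure of ideals cover it.\<close>

lemma smult_free_algebra: "c \<odot>\<^bsub>free_algebra n\<^esub> f = Poly_Mapping.single [] c * f"
proof -
  have "Poly_Mapping.map ((*) c) f = Poly_Mapping.single [] c * f"
  proof (induct f rule: poly_mapping_single_induct)
    case (1 w d)
    then show ?case by (intro poly_mapping_eqI) (simp add: map.rep_eq lookup_single when_def)
  next
    case (2 f g)
    have "Poly_Mapping.map ((*) c) (f + g) = Poly_Mapping.map ((*) c) f + Poly_Mapping.map ((*) c) g"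
      by (intro poly_mapping_eqI) (simp add: map.rep_eq lookup_add when_def distrib_left, metis distrib_left mult_zero_right)
    with 2 show ?case by (simp add: distrib_left)
  qed
  then show ?thesis by (simp add: free_algebra_def)
qed

text \<open>Letters are split off on the left, the side on which \<open>n\<close> acts on
  \<open>U(n)\<close>, and all intermediate elements stay in the carrier.\<close>

lemma free_algebra_induct [consumes 1, case_names scalar letter add]:
  assumes f: "f \<in> carrier (free_algebra n)"
    and "\<And>c. P (Poly_Mapping.single [] c)"
    and "\<And>x g. x \<in> n \<Longrightarrow> g \<in> carrier (free_algebra n) \<Longrightarrow> P g \<Longrightarrow> P (word [x] * g)"
    and "\<And>f g. f \<in> carrier (free_algebra n) \<Longrightarrow> g \<in> carrier (free_algebra n) \<Longrightarrow> P f \<Longrightarrow> P g \<Longrightarrow> P (f + g)"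
  shows "P f"
proof -
  have single: "P (Poly_Mapping.single w c)" if "set w \<subseteq> n" for w c
    using that
  proof (induct w)
    case (Cons x w)
    then have "P (word [x] * Poly_Mapping.single w c)" by (intro assms) (auto intro: single_free_algebra)
    then show ?case by (simp add: mult_single plus_list_def)
  qed (use assms in auto)
  \<comment> \<open>Each update adds a new key with nonzero coefficient, so nothing cancels and both
    summands remain supported on words over \<open>n\<close>.\<close>
  have "Poly_Mapping.keys f \<subseteq> lists n \<longrightarrow> P f"
  proof (induct f rule: update_induct)
    case const
    show ?case using assms(2)[of 0] by simp
  next
    case (update f w c)
    have keys: "Poly_Mapping.keys (Poly_Mapping.update w c f) = insert w (Poly_Mapping.keys f)"
      using update by (auto simp: keys_update)
    have "Poly_Mapping.update w c f = f + Poly_Mapping.single w c"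
      using update by (intro poly_mapping_eqI) (auto simp: lookup_update lookup_add lookup_single when_def in_keys_iff)
    then show ?case using update keys single[of w c] single_free_algebra[of w n c]
      by (auto intro!: assms(4) simp: free_algebra_def)
  qed
  then show ?thesis using f by (simp add: free_algebra_def)
qed

lemma free_derivation_Nil [simp]: "free_derivation br z (Poly_Mapping.single [] c) = 0"
  by (simp add: free_derivation_single)

lemma free_derivation_letter [simp]: "free_derivation br z (Poly_Mapping.single [x] c) = Poly_Mapping.single [br z x] c"
  by (simp add: free_derivation_single)

lemma free_derivation_scalar: "free_derivation br z (Poly_Mapping.single [] c * f) = Poly_Mapping.single [] c * free_derivation br z f"
  by (simp add: free_derivation_mult)

section \<open>Enveloping ideals of subalgebras and the derivations preserving them\<close>

context lie_algebra begin

abbreviation env_ideal :: "'g set \<Rightarrow> ('g list \<Rightarrow>\<^sub>0 complex) set" where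
  "env_ideal \<equiv> enveloping_ideal scale bracket"

lemma bracket_zero_left [simp]: "bracket 0 x = 0" and bracket_zero_right [simp]: "bracket x 0 = 0"
  using bracket_add_left[of 0 0 x] bracket_add_right[of x 0 0] by simp_all

lemma bracket_minus_right: "bracket x (- y) = - bracket x y"
  using bracket_add_right[of x y "- y"] by (simp add: eq_neg_iff_add_eq_0 add.commute)

lemma bracket_anticommute: "bracket y x = - bracket x y"
  using bracket_self[of "x + y", unfolded bracket_add_left bracket_add_right]
  by (simp add: bracket_self eq_neg_iff_add_eq_0 add.commute)

lemma bracket_derivation: "bracket z (bracket x y) = bracket (bracket z x) y + bracket x (bracket z y)"
proof -
  have "bracket x (bracket y z) = - bracket x (bracket z y)" "bracket y (bracket z x) = - bracket (bracket z x) y"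
    using bracket_anticommute[of y z] bracket_anticommute[of y "bracket z x"] by (simp_all add: bracket_minus_right)
  with jacobi[of z x y] show ?thesis by (simp add: algebra_simps eq_neg_iff_add_eq_0)
qed

lemma bracket_bracket_left: "bracket (bracket z w) x = bracket z (bracket w x) - bracket w (bracket z x)"
  by (simp add: bracket_derivation[of z w x])

lemma lie_ideal_subalgebra: "lie_ideal n \<Longrightarrow> lie_subalgebra n"
  by (simp add: lie_ideal_def lie_subalgebra_def)

lemma subalgebra_closed:
  assumes "lie_subalgebra n"
  shows "0 \<in> n" "x \<in> n \<Longrightarrow> y \<in> n \<Longrightarrow> x + y \<in> n" "x \<in> n \<Longrightarrow> scale c x \<in> n"
    "x \<in> n \<Longrightarrow> y \<in> n \<Longrightarrow> bracket x y \<in> n" "x \<in> n \<Longrightarrow> y \<in> n \<Longrightarrow> x - y \<in> n"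
  using assms by (auto simp: lie_subalgebra_def subspace_0 subspace_add subspace_scale subspace_diff)

text \<open>Stated for subalgebras: in the induction on dimension the smaller algebra is an ideal of
  \<open>n\<close>, but not necessarily of the whole Lie algebra.\<close>

lemma relations_closed:
  assumes n: "lie_subalgebra n"
  shows "enveloping_relations scale bracket n \<subseteq> carrier (free_algebra n)"
  unfolding enveloping_relations_def using subalgebra_closed[OF n]
  by (auto intro!: free_algebra_closed)

lemma env_ideal_ideal:
  assumes "lie_subalgebra n"
  shows "ideal (env_ideal n) (free_algebra n)"
  unfolding enveloping_ideal_def by (intro ring.genideal_ideal ring_free_algebra relations_closed assms)

lemma env_ideal_closed:
  assumes n: "lie_subalgebra n"
  shows "f \<in> env_ideal n \<Longrightarrow> f \<in> carrier (free_algebra n)"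
    and "0 \<in> env_ideal n"
    and "f \<in> env_ideal n \<Longrightarrow> g \<in> env_ideal n \<Longrightarrow> f + g \<in> env_ideal n"
    and "f \<in> env_ideal n \<Longrightarrow> - f \<in> env_ideal n"
    and "f \<in> env_ideal n \<Longrightarrow> g \<in> env_ideal n \<Longrightarrow> f - g \<in> env_ideal n"
    and "f \<in> env_ideal n \<Longrightarrow> g \<in> carrier (free_algebra n) \<Longrightarrow> g * f \<in> env_ideal n"
    and "f \<in> env_ideal n \<Longrightarrow> g \<in> carrier (free_algebra n) \<Longrightarrow> f * g \<in> env_ideal n"
proof -
  interpret J: ideal "env_ideal n" "free_algebra n" by (rule env_ideal_ideal[OF n])
  have sub: "f \<in> carrier (free_algebra n)" if "f \<in> env_ideal n" for f using that J.a_subset by auto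
  have neg: "- f \<in> env_ideal n" if "f \<in> env_ideal n" for f
    using additive_subgroup.a_inv_closed[OF J.is_additive_subgroup that] uminus_free_algebra[OF sub[OF that]] by simp
  have add: "f + g \<in> env_ideal n" if "f \<in> env_ideal n" "g \<in> env_ideal n" for f g
    using additive_subgroup.a_closed[OF J.is_additive_subgroup that] by simp
  show "f \<in> env_ideal n \<Longrightarrow> f \<in> carrier (free_algebra n)" by (rule sub)
  show "0 \<in> env_ideal n" using additive_subgroup.zero_closed[OF J.is_additive_subgroup] by simp
  show "f \<in> env_ideal n \<Longrightarrow> g \<in> env_ideal n \<Longrightarrow> f + g \<in> env_ideal n" by (rule add)
  show "f \<in> env_ideal n \<Longrightarrow> - f \<in> env_ideal n" by (rule neg)
  show "f \<in> env_ideal n \<Longrightarrow> g \<in> env_ideal n \<Longrightarrow> f - g \<in> env_ideal n" using add[of f "- g"] neg by simp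
  show "f \<in> env_ideal n \<Longrightarrow> g \<in> carrier (free_algebra n) \<Longrightarrow> g * f \<in> env_ideal n" using J.I_l_closed by simp
  show "f \<in> env_ideal n \<Longrightarrow> g \<in> carrier (free_algebra n) \<Longrightarrow> f * g \<in> env_ideal n" using J.I_r_closed by simp
qed

lemma env_ideal_relations:
  assumes n: "lie_subalgebra n"
  shows "x \<in> n \<Longrightarrow> y \<in> n \<Longrightarrow> word [x + y] - word [x] - word [y] \<in> env_ideal n"
    and "x \<in> n \<Longrightarrow> word [scale c x] - Poly_Mapping.single [x] c \<in> env_ideal n"
    and "x \<in> n \<Longrightarrow> y \<in> n \<Longrightarrow> word [x] * word [y] - word [y] * word [x] - word [bracket x y] \<in> env_ideal n"
proof -
  have sub: "enveloping_relations scale bracket n \<subseteq> env_ideal n" unfolding enveloping_ideal_def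
    by (intro ring.genideal_self ring_free_algebra relations_closed n)
  show "word [x + y] - word [x] - word [y] \<in> env_ideal n" if "x \<in> n" "y \<in> n"
    using that by (intro subsetD[OF sub]) (unfold enveloping_relations_def, blast)
  show "word [scale c x] - Poly_Mapping.single [x] c \<in> env_ideal n" if "x \<in> n"
    using that by (intro subsetD[OF sub]) (unfold enveloping_relations_def, blast)
  show "word [x] * word [y] - word [y] * word [x] - word [bracket x y] \<in> env_ideal n" if "x \<in> n" "y \<in> n"
    using that by (intro subsetD[OF sub]) (unfold enveloping_relations_def, blast)
qed

text \<open>The members of \<open>env_ideal n\<close> that satisfy \<open>P\<close> form an ideal
  containing the relations, and \<open>env_ideal n\<close> is the smallest such ideal.\<close>

lemma env_ideal_induct [consumes 2, case_names plus scale bracket zero add left right]: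
  assumes n: "lie_subalgebra n" and f: "f \<in> env_ideal n"
    and r1: "\<And>x y. x \<in> n \<Longrightarrow> y \<in> n \<Longrightarrow> P (word [x + y] - word [x] - word [y])"
    and r2: "\<And>c x. x \<in> n \<Longrightarrow> P (word [scale c x] - Poly_Mapping.single [x] c)"
    and r3: "\<And>x y. x \<in> n \<Longrightarrow> y \<in> n \<Longrightarrow> P (word [x] * word [y] - word [y] * word [x] - word [bracket x y])"
    and P0: "P 0"
    and Padd: "\<And>f g. f \<in> env_ideal n \<Longrightarrow> g \<in> env_ideal n \<Longrightarrow> P f \<Longrightarrow> P g \<Longrightarrow> P (f + g)"
    and Pleft: "\<And>f g. f \<in> env_ideal n \<Longrightarrow> g \<in> carrier (free_algebra n) \<Longrightarrow> P f \<Longrightarrow> P (g * f)"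
    and Pright: "\<And>f g. f \<in> env_ideal n \<Longrightarrow> g \<in> carrier (free_algebra n) \<Longrightarrow> P f \<Longrightarrow> P (f * g)"
  shows "P f"
proof -
  let ?F = "free_algebra n" and ?K = "{f \<in> env_ideal n. P f}"
  note J = env_ideal_closed[OF n]
  \<comment> \<open>Negation is left multiplication by the scalar -1, so the case
    \<open>left\<close> yields the additive inverses.\<close>
  have Pneg: "P (- f)" if "f \<in> env_ideal n" "P f" for f
    using Pleft[OF that(1) _ that(2), of "- 1"] free_algebra_closed(6)[of "[]" n 1]
    by (simp add: free_algebra_closed)
  have K: "ideal ?K ?F"
  proof (rule idealI)
    show "subgroup ?K (add_monoid ?F)"
    proof (rule group.subgroupI[OF abelian_group.a_group])
      show "abelian_group ?F" using ring_free_algebra ring.is_abelian_group by blast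
      show "?K \<noteq> {}" using J(2) P0 by auto
      show "?K \<subseteq> carrier (add_monoid ?F)" using J(1) by auto
      show "inv\<^bsub>add_monoid ?F\<^esub> a \<in> ?K" if "a \<in> ?K" for a
      proof -
        have "inv\<^bsub>add_monoid ?F\<^esub> a = - a" using that J(1) uminus_free_algebra[of a n] by (auto simp: a_inv_def)
        then show ?thesis using that J Pneg by simp
      qed
    qed (auto simp: J Padd)
  qed (auto intro: ring_free_algebra simp: J Pleft Pright)
  have "enveloping_relations scale bracket n \<subseteq> ?K"
    unfolding enveloping_relations_def
    by (intro Un_least subsetI; elim CollectE exE conjE; simp only: mem_Collect_eq)
      (intro conjI env_ideal_relations[OF n] r1 r2 r3; assumption)+
  then have "env_ideal n \<subseteq> ?K"
    using ring.genideal_minimal[OF ring_free_algebra K] by (simp only: enveloping_ideal_def)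
  with f show ?thesis by blast
qed

text \<open>Each relation goes to a combination of relations, and the Leibniz rule carries this over
  to products. The element \<open>z\<close> may lie outside \<open>n\<close> as long as it
  normalises it.\<close>

lemma free_derivation_env_ideal:
  assumes n: "lie_subalgebra n" and z: "\<And>x. x \<in> n \<Longrightarrow> bracket z x \<in> n" and f: "f \<in> env_ideal n"
  shows "free_derivation bracket z f \<in> env_ideal n"
  using n f
proof (induct f rule: env_ideal_induct)
  case (plus x y)
  show ?case unfolding free_derivation_diff free_derivation_letter bracket_add_right
    by (intro env_ideal_relations(1)[OF n] z plus)
next
  case (scale c x)
  show ?case unfolding free_derivation_diff free_derivation_letter bracket_scale_right
    by (intro env_ideal_relations(2)[OF n] z scale)
next
  case (bracket x y)
  have zxy: "bracket z x \<in> n" "bracket z y \<in> n" using z bracket by blast+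
  have m: "word [bracket z x] * word [y] - word [y] * word [bracket z x] - word [bracket (bracket z x) y] \<in> env_ideal n"
         "word [x] * word [bracket z y] - word [bracket z y] * word [x] - word [bracket x (bracket z y)] \<in> env_ideal n"
         "word [bracket (bracket z x) y + bracket x (bracket z y)] - word [bracket (bracket z x) y] - word [bracket x (bracket z y)] \<in> env_ideal n"
    by (rule env_ideal_relations[OF n] subalgebra_closed(4)[OF n] zxy bracket)+
  \<comment> \<open>By the Jacobi identity the commutator relation for x, y goes to those for [z,x],
    y and for x, [z,y], up to one additivity relation.\<close>
  have "free_derivation bracket z (word [x] * word [y] - word [y] * word [x] - word [bracket x y]) =
     (word [bracket z x] * word [y] - word [y] * word [bracket z x] - word [bracket (bracket z x) y]) +
     (word [x] * word [bracket z y] - word [bracket z y] * word [x] - word [bracket x (bracket z y)]) -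
     (word [bracket (bracket z x) y + bracket x (bracket z y)] - word [bracket (bracket z x) y] - word [bracket x (bracket z y)])"
    unfolding free_derivation_diff free_derivation_mult free_derivation_letter bracket_derivation[of z x y]
    by (simp add: algebra_simps)
  then show ?case using env_ideal_closed(5)[OF n env_ideal_closed(3)[OF n m(1,2)] m(3)] by (simp only:)
next
  case (left f g)
  then show ?case unfolding free_derivation_mult
    by (intro env_ideal_closed(3,6)[OF n] free_derivation_closed z)
next
  case (right f g)
  then show ?case unfolding free_derivation_mult
    by (intro env_ideal_closed(3,7)[OF n] free_derivation_closed z)
qed (simp_all add: free_derivation_add env_ideal_closed(2,3)[OF n])

text \<open>By the Leibniz rule the letters decide. With \<open>E\<close> the difference of two
  sides of an identity between derivations, the identity holds modulo the ideal once it holds on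
  letters.\<close>

lemma derivation_into_env_ideal:
  assumes n: "lie_subalgebra n" and f: "f \<in> carrier (free_algebra n)"
    and add: "\<And>f g. E (f + g) = E f + E g" and mult: "\<And>f g. E (f * g) = E f * g + f * E g"
    and scalar: "\<And>c. E (Poly_Mapping.single [] c) = 0"
    and letter: "\<And>x. x \<in> n \<Longrightarrow> E (word [x]) \<in> env_ideal n"
  shows "E f \<in> env_ideal n"
  using f
proof (induct f rule: free_algebra_induct)
  case (letter x g)
  have "E (word [x]) * g \<in> env_ideal n" using letter assms(6) by (intro env_ideal_closed(7)[OF n])
  moreover have "word [x] * E g \<in> env_ideal n" using letter by (intro env_ideal_closed(6)[OF n] single_free_algebra) auto
  ultimately show ?case by (simp add: mult env_ideal_closed[OF n])
qed (simp_all add: scalar add env_ideal_closed[OF n])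

text \<open>These identities hold only modulo the ideal, since in the free algebra the letter of a
  sum is not the sum of the letters. Each difference is a derivation, so it is checked on
  letters.\<close>

lemma free_derivation_linear_mod:
  assumes n: "lie_subalgebra n" and f: "f \<in> carrier (free_algebra n)"
    and z: "\<And>x. x \<in> n \<Longrightarrow> bracket z x \<in> n" and w: "\<And>x. x \<in> n \<Longrightarrow> bracket w x \<in> n"
  shows "free_derivation bracket (z + w) f - free_derivation bracket z f - free_derivation bracket w f \<in> env_ideal n"
    and "free_derivation bracket (scale c z) f - Poly_Mapping.single [] c * free_derivation bracket z f \<in> env_ideal n"
    and "free_derivation bracket (bracket z w) f -
      (free_derivation bracket z (free_derivation bracket w f) - free_derivation bracket w (free_derivation bracket z f)) \<in> env_ideal n"
proof -
  show "free_derivation bracket (z + w) f - free_derivation bracket z f - free_derivation bracket w f \<in> env_ideal n"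
    using n f
  proof (rule derivation_into_env_ideal)
    fix x assume "x \<in> n"
    then show "free_derivation bracket (z + w) (word [x]) - free_derivation bracket z (word [x]) - free_derivation bracket w (word [x]) \<in> env_ideal n"
      using env_ideal_relations(1)[OF n z w] by (simp add: bracket_add_left)
  qed (simp_all add: free_derivation_add free_derivation_mult algebra_simps)
  show "free_derivation bracket (scale c z) f - Poly_Mapping.single [] c * free_derivation bracket z f \<in> env_ideal n"
    using n f
  proof (rule derivation_into_env_ideal)
    fix f g
    have "f * (Poly_Mapping.single [] c * free_derivation bracket z g) = Poly_Mapping.single [] c * (f * free_derivation bracket z g)"
      by (metis mult.assoc single_Nil_commute)
    then show "free_derivation bracket (scale c z) (f * g) - Poly_Mapping.single [] c * free_derivation bracket z (f * g) =
      (free_derivation bracket (scale c z) f - Poly_Mapping.single [] c * free_derivation bracket z f) * g +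
      f * (free_derivation bracket (scale c z) g - Poly_Mapping.single [] c * free_derivation bracket z g)"
      by (simp add: free_derivation_mult algebra_simps)
  qed (simp_all add: free_derivation_add algebra_simps bracket_scale_left env_ideal_relations(2)[OF n z])
  show "free_derivation bracket (bracket z w) f -
      (free_derivation bracket z (free_derivation bracket w f) - free_derivation bracket w (free_derivation bracket z f)) \<in> env_ideal n"
    using n f
  proof (rule derivation_into_env_ideal)
    fix x assume "x \<in> n"
    then have zwx: "bracket z (bracket w x) \<in> n" "bracket w (bracket z x) \<in> n" using z w by auto
    let ?a = "bracket z (bracket w x)" and ?b = "bracket w (bracket z x)"
    \<comment> \<open>The relations speak of sums, so the difference is reached through a = (a - b)
      + b.\<close>
    have "- (word [(?a - ?b) + ?b] - word [?a - ?b] - word [?b]) \<in> env_ideal n"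
      by (intro env_ideal_closed(4)[OF n] env_ideal_relations[OF n] subalgebra_closed[OF n] zwx)
    then show "free_derivation bracket (bracket z w) (word [x]) - (free_derivation bracket z (free_derivation bracket w (word [x])) - free_derivation bracket w (free_derivation bracket z (word [x]))) \<in> env_ideal n"
      by (simp add: bracket_bracket_left algebra_simps)
  qed (simp_all add: free_derivation_add free_derivation_mult algebra_simps)
qed

lemma word_diff_mod:
  assumes n: "lie_subalgebra n" and "x \<in> n" "y \<in> n"
  shows "word [x - y] - (word [x] - word [y]) \<in> env_ideal n"
proof -
  have "- (word [(x - y) + y] - word [x - y] - word [y]) \<in> env_ideal n"
    by (intro env_ideal_closed(4)[OF n] env_ideal_relations[OF n] subalgebra_closed[OF n] assms)
  then show ?thesis by (simp add: algebra_simps)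
qed

end

section \<open>The action of \<open>s\<close> on \<open>U(m)\<close> through representatives\<close>

text \<open>Here \<open>\<pi>\<close> is the projection of \<open>s\<close> onto a complement of its ideal \<open>m\<close>. It is used both for
  \<open>s = p \<ltimes> n\<close>, \<open>m = n\<close> and, in the induction on \<open>dim n\<close>, for \<open>s = n\<close> and an ideal \<open>m\<close> of codimension 1.\<close>

locale split_lie_algebra = lie_algebra scale bracket
  for scale :: "complex \<Rightarrow> 'g::ab_group_add \<Rightarrow> 'g" and bracket +
  fixes s m :: "'g set" and \<pi> :: "'g \<Rightarrow> 'g"
  assumes s: "lie_subalgebra s" and m: "lie_subalgebra m"
    and proj_in: "y \<in> s \<Longrightarrow> \<pi> y \<in> s" and diff_in: "y \<in> s \<Longrightarrow> y - \<pi> y \<in> m"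
    and proj_add: "y \<in> s \<Longrightarrow> y' \<in> s \<Longrightarrow> \<pi> (y + y') = \<pi> y + \<pi> y'"
    and proj_scale: "y \<in> s \<Longrightarrow> \<pi> (scale c y) = scale c (\<pi> y)"
    and proj_bracket: "y \<in> s \<Longrightarrow> y' \<in> s \<Longrightarrow> \<pi> (bracket y y') = bracket (\<pi> y) (\<pi> y')"
    and bracket_in: "z \<in> s \<Longrightarrow> x \<in> m \<Longrightarrow> bracket z x \<in> m"
begin

text \<open>A lift of the action on \<open>U(m)\<close> to representatives: additivity in the second
  argument is exact, while linearity in \<open>y\<close> and the bracket identity hold modulo
  \<open>env_ideal m\<close>.\<close>

definition free_action :: "'g \<Rightarrow> ('g list \<Rightarrow>\<^sub>0 complex) \<Rightarrow> ('g list \<Rightarrow>\<^sub>0 complex)" where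
  "free_action y f = free_derivation bracket (\<pi> y) f + word [y - \<pi> y] * f"

lemma free_action_add: "free_action y (f + g) = free_action y f + free_action y g"
  by (simp add: free_action_def free_derivation_add algebra_simps)

lemma free_action_zero [simp]: "free_action y 0 = 0"
  using free_action_add[of y 0 0] by simp

lemma free_action_scalar: "free_action y (Poly_Mapping.single [] c * f) = Poly_Mapping.single [] c * free_action y f"
proof -
  have "word [y - \<pi> y] * (Poly_Mapping.single [] c * f) = Poly_Mapping.single [] c * (word [y - \<pi> y] * f)"
    by (metis mult.assoc single_Nil_commute)
  then show ?thesis by (simp add: free_action_def free_derivation_scalar distrib_left)
qed

lemma proj_bracket_in: "y \<in> s \<Longrightarrow> x \<in> m \<Longrightarrow> bracket (\<pi> y) x \<in> m"
  by (intro bracket_in proj_in)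

lemma free_action_closed:
  assumes "y \<in> s" "f \<in> carrier (free_algebra m)"
  shows "free_action y f \<in> carrier (free_algebra m)"
  unfolding free_action_def using assms
  by (intro add_free_algebra mult_free_algebra free_derivation_closed single_free_algebra proj_bracket_in)
    (auto intro: diff_in)

lemma free_action_env_ideal:
  assumes "y \<in> s" "f \<in> env_ideal m"
  shows "free_action y f \<in> env_ideal m"
  unfolding free_action_def using assms
  by (intro env_ideal_closed(3,6)[OF m] free_derivation_env_ideal[OF m] single_free_algebra proj_bracket_in)
    (auto intro: diff_in)

lemma free_action_plus:
  assumes y: "y \<in> s" "y' \<in> s" and f: "f \<in> carrier (free_algebra m)"
  shows "free_action (y + y') f - free_action y f - free_action y' f \<in> env_ideal m"
proof -
  let ?u = "y - \<pi> y" and ?u' = "y' - \<pi> y'"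
  have 1: "free_derivation bracket (\<pi> y + \<pi> y') f - free_derivation bracket (\<pi> y) f - free_derivation bracket (\<pi> y') f \<in> env_ideal m"
    using y by (intro free_derivation_linear_mod(1)[OF m f] proj_bracket_in)
  have 2: "(word [?u + ?u'] - word [?u] - word [?u']) * f \<in> env_ideal m"
    using y by (intro env_ideal_closed(7)[OF m _ f] env_ideal_relations[OF m] diff_in)
  have u: "y + y' - (\<pi> y + \<pi> y') = ?u + ?u'" by simp
  have "free_action (y + y') f - free_action y f - free_action y' f =
    (free_derivation bracket (\<pi> y + \<pi> y') f - free_derivation bracket (\<pi> y) f - free_derivation bracket (\<pi> y') f) +
    (word [?u + ?u'] - word [?u] - word [?u']) * f"
    unfolding free_action_def proj_add[OF y] left_diff_distrib u by simp
  then show ?thesis using env_ideal_closed(3)[OF m 1 2] by simp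
qed

lemma free_action_scale:
  assumes y: "y \<in> s" and f: "f \<in> carrier (free_algebra m)"
  shows "free_action (scale c y) f - Poly_Mapping.single [] c * free_action y f \<in> env_ideal m"
proof -
  let ?u = "y - \<pi> y"
  have 1: "free_derivation bracket (scale c (\<pi> y)) f - Poly_Mapping.single [] c * free_derivation bracket (\<pi> y) f \<in> env_ideal m"
    using y by (intro free_derivation_linear_mod(2)[OF m f, where w = 0] proj_bracket_in) (auto simp: subalgebra_closed(1)[OF m])
  have 2: "(word [scale c ?u] - Poly_Mapping.single [?u] c) * f \<in> env_ideal m"
    using y by (intro env_ideal_closed(7)[OF m _ f] env_ideal_relations[OF m] diff_in)
  have "scale c y - \<pi> (scale c y) = scale c ?u" using y by (simp add: proj_scale scale_right_diff_distrib)
  moreover have "Poly_Mapping.single [?u] c = Poly_Mapping.single [] c * word [?u]" by simp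
  ultimately have "free_action (scale c y) f - Poly_Mapping.single [] c * free_action y f =
    (free_derivation bracket (scale c (\<pi> y)) f - Poly_Mapping.single [] c * free_derivation bracket (\<pi> y) f) +
    (word [scale c ?u] - Poly_Mapping.single [?u] c) * f"
    using y by (simp only: free_action_def proj_scale left_diff_distrib distrib_left mult.assoc) simp
  then show ?thesis using env_ideal_closed(3)[OF m 1 2] by simp
qed

text \<open>Write y = z + u with z = \<pi> y and u in \<open>m\<close>. The component of [y,y'] in
  \<open>m\<close> is [z,u'] - [z',u] + [u,u'], and modulo the ideal these terms are the commutators
  that involve a left multiplication.\<close>

lemma free_action_bracket:
  assumes y: "y \<in> s" "y' \<in> s" and f: "f \<in> carrier (free_algebra m)"
  shows "free_action (bracket y y') f - (free_action y (free_action y' f) - free_action y' (free_action y f)) \<in> env_ideal m"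
proof -
  let ?z = "\<pi> y" and ?z' = "\<pi> y'" and ?u = "y - \<pi> y" and ?u' = "y' - \<pi> y'" and ?D = "free_derivation bracket"
  let ?a = "bracket ?z ?u'" and ?b = "bracket ?z' ?u" and ?c = "bracket ?u ?u'"
  have um: "?u \<in> m" "?u' \<in> m" using y diff_in by auto
  have abc: "?a \<in> m" "?b \<in> m" "?c \<in> m" using um y proj_bracket_in subalgebra_closed(4)[OF m] by auto
  have ab: "?a - ?b \<in> m" by (rule subalgebra_closed(5)[OF m abc(1,2)])
  have 1: "?D (bracket ?z ?z') f - (?D ?z (?D ?z' f) - ?D ?z' (?D ?z f)) \<in> env_ideal m"
    using y by (intro free_derivation_linear_mod(3)[OF m f] proj_bracket_in)
  have 2: "(word [(?a - ?b) + ?c] - word [?a - ?b] - word [?c]) * f \<in> env_ideal m"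
    by (intro env_ideal_closed(7)[OF m _ f] env_ideal_relations[OF m] ab abc)
  have 3: "(word [?a - ?b] - (word [?a] - word [?b])) * f \<in> env_ideal m"
    by (intro env_ideal_closed(7)[OF m _ f] word_diff_mod[OF m] abc)
  have 4: "(word [?u] * word [?u'] - word [?u'] * word [?u] - word [?c]) * f \<in> env_ideal m"
    by (intro env_ideal_closed(7)[OF m _ f] env_ideal_relations[OF m] um)
  have "bracket y y' = bracket (?z + ?u) (?z' + ?u')" by simp
  also have "\<dots> = bracket ?z ?z' + ((?a - ?b) + ?c)"
    using bracket_anticommute[of ?u ?z'] by (simp only: bracket_add_left bracket_add_right) simp
  finally have "bracket y y' - \<pi> (bracket y y') = (?a - ?b) + ?c"
    unfolding proj_bracket[OF y] by (metis add_diff_cancel_left')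
  then have R: "free_action (bracket y y') f = ?D (bracket ?z ?z') f + word [(?a - ?b) + ?c] * f"
    using y by (simp add: free_action_def proj_bracket)
  have A: "?D z (word [u] * g) = word [bracket z u] * g + word [u] * ?D z g" for z u g
    by (simp add: free_derivation_mult)
  \<comment> \<open>The terms with one derivation and one left multiplication are the same in both
    composites and cancel in the difference.\<close>
  have L: "free_action y (free_action y' f) =
      ?D ?z (?D ?z' f) + word [?a] * f + word [?u'] * ?D ?z f + word [?u] * ?D ?z' f + word [?u] * word [?u'] * f"
    "free_action y' (free_action y f) =
      ?D ?z' (?D ?z f) + word [?b] * f + word [?u] * ?D ?z' f + word [?u'] * ?D ?z f + word [?u'] * word [?u] * f"
    by (simp_all only: free_action_def free_derivation_add A distrib_left mult.assoc add.assoc)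
  have "free_action (bracket y y') f - (free_action y (free_action y' f) - free_action y' (free_action y f)) =
    ((?D (bracket ?z ?z') f - (?D ?z (?D ?z' f) - ?D ?z' (?D ?z f))) +
    (word [(?a - ?b) + ?c] - word [?a - ?b] - word [?c]) * f) +
    ((word [?a - ?b] - (word [?a] - word [?b])) * f -
    (word [?u] * word [?u'] - word [?u'] * word [?u] - word [?c]) * f)"
    unfolding R L left_diff_distrib by simp
  then show ?thesis
    using env_ideal_closed(3)[OF m env_ideal_closed(3)[OF m 1 2] env_ideal_closed(5)[OF m 3 4]] by (simp only:)
qed

end

section \<open>Extension to the free algebra, and weights\<close>

text \<open>\<open>\<phi>\<close> receives the coefficient as an argument, so that the target needs
  only an addition. It is used with complex values and with values in a free algebra.\<close>

definition linear_extension :: "('a \<Rightarrow> complex \<Rightarrow> 'v::comm_monoid_add) \<Rightarrow> ('a \<Rightarrow>\<^sub>0 complex) \<Rightarrow> 'v" where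
  "linear_extension \<phi> f = (\<Sum>w\<in>Poly_Mapping.keys f. \<phi> w (Poly_Mapping.lookup f w))"

lemma linear_extension_superset:
  assumes "finite A" "Poly_Mapping.keys f \<subseteq> A" "\<And>w. \<phi> w 0 = 0"
  shows "linear_extension \<phi> f = (\<Sum>w\<in>A. \<phi> w (Poly_Mapping.lookup f w))"
  unfolding linear_extension_def
  by (rule sum.mono_neutral_left) (use assms in \<open>auto simp: in_keys_iff\<close>)

lemma linear_extension_single: "(\<And>w. \<phi> w 0 = 0) \<Longrightarrow> linear_extension \<phi> (Poly_Mapping.single w c) = \<phi> w c"
  by (subst linear_extension_superset[of "{w}"]) auto

lemma linear_extension_add:
  assumes "\<And>w. \<phi> w 0 = 0" "\<And>w a b. \<phi> w (a + b) = \<phi> w a + \<phi> w b"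
  shows "linear_extension \<phi> (f + g) = linear_extension \<phi> f + linear_extension \<phi> g"
  using Poly_Mapping.keys_add[of f g] assms
  by (simp add: linear_extension_superset[of "Poly_Mapping.keys f \<union> Poly_Mapping.keys g"] lookup_add sum.distrib)

text \<open>The coefficient of t under the algebra map to the polynomials in t that sends a letter x
  to \<psi>(x) t. The constant coefficient is the value at the empty word.\<close>

definition free_linear_part :: "('a \<Rightarrow> complex) \<Rightarrow> ('a list \<Rightarrow>\<^sub>0 complex) \<Rightarrow> complex" where
  "free_linear_part \<psi> = linear_extension (\<lambda>w c. if length w = 1 then c * \<psi> (hd w) else 0)"

lemma free_linear_part_add: "free_linear_part \<psi> (f + g) = free_linear_part \<psi> f + free_linear_part \<psi> g"
  unfolding free_linear_part_def by (rule linear_extension_add) (simp_all add: distrib_right)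

lemma free_linear_part_single: "free_linear_part \<psi> (Poly_Mapping.single w c) = (if length w = 1 then c * \<psi> (hd w) else 0)"
  unfolding free_linear_part_def by (rule linear_extension_single) simp

lemma free_linear_part_diff: "free_linear_part \<psi> (f - g) = free_linear_part \<psi> f - free_linear_part \<psi> g"
  using free_linear_part_add[of \<psi> "f - g" g] by simp

lemma free_linear_part_zero [simp]: "free_linear_part \<psi> 0 = 0"
  using free_linear_part_add[of \<psi> 0 0] by simp

lemma lookup_Nil_mult: "Poly_Mapping.lookup (f * g) [] = Poly_Mapping.lookup f [] * Poly_Mapping.lookup g ([] :: 'a list) "
  for f g :: "'a list \<Rightarrow>\<^sub>0 complex"
proof (induct f rule: poly_mapping_single_induct)
  case (1 v a)
  show ?case
    by (induct g rule: poly_mapping_single_induct)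
      (simp_all add: mult_single lookup_single plus_list_def when_def lookup_add distrib_left)
qed (simp add: lookup_add distrib_right)

text \<open>A product of two words has length 1 exactly when one is a letter and the other is empty;
  this is multiplication of polynomials modulo the square of t.\<close>

lemma free_linear_part_mult:
  "free_linear_part \<psi> (f * g) = free_linear_part \<psi> f * Poly_Mapping.lookup g [] + Poly_Mapping.lookup f [] * free_linear_part \<psi> g"
proof (induct f rule: poly_mapping_single_induct)
  case (1 v a)
  show ?case
  proof (induct g rule: poly_mapping_single_induct)
    case (1 w b)
    show ?case
      by (cases v; cases w) (auto simp: mult_single free_linear_part_single lookup_single plus_list_def)
  qed (simp add: free_linear_part_add lookup_add distrib_left)
qed (simp add: free_linear_part_add lookup_add distrib_right)

section \<open>Linear functionals and weights\<close>

context lie_algebra begin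

text \<open>The map to polynomials modulo the square of t kills the relations because \<psi> is
  linear and vanishes on brackets. Both coefficients are treated together, as the product rule for
  the second involves the first.\<close>

lemma free_linear_part_env_ideal:
  assumes n: "lie_subalgebra n" and f: "f \<in> env_ideal n"
    and add: "\<And>x y. \<psi> (x + y) = \<psi> x + \<psi> y" and scale: "\<And>c x. \<psi> (scale c x) = c * \<psi> x"
    and bracket: "\<And>x y. x \<in> n \<Longrightarrow> y \<in> n \<Longrightarrow> \<psi> (bracket x y) = 0"
  shows "Poly_Mapping.lookup f [] = 0 \<and> free_linear_part \<psi> f = 0"
  using n f
  by (induct f rule: env_ideal_induct)
    (auto simp: free_linear_part_diff free_linear_part_single free_linear_part_mult free_linear_part_add
      lookup_minus lookup_add lookup_single lookup_Nil_mult add scale bracket)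

text \<open>Up to \<open>env_ideal n\<close> such an element is a combination of products of letters
  from terms of \<open>G\<close> whose indices add up to at least \<open>j\<close>. The rule
  \<open>ideal\<close> makes this a property of the class in \<open>U(n)\<close>.\<close>

inductive weight_ge :: "(nat \<Rightarrow> 'g set) \<Rightarrow> 'g set \<Rightarrow> nat \<Rightarrow> ('g list \<Rightarrow>\<^sub>0 complex) \<Rightarrow> bool"
  for G :: "nat \<Rightarrow> 'g set" and n :: "'g set" where
  ideal: "f \<in> env_ideal n \<Longrightarrow> weight_ge G n j f"
| scalar: "weight_ge G n 0 (Poly_Mapping.single [] c)"
| add: "weight_ge G n j f \<Longrightarrow> weight_ge G n j g \<Longrightarrow> weight_ge G n j (f + g)"
| letter: "x \<in> n \<Longrightarrow> x \<in> G i \<Longrightarrow> weight_ge G n j f \<Longrightarrow> weight_ge G n (i + j) (word [x] * f)"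
| mono: "weight_ge G n j f \<Longrightarrow> i \<le> j \<Longrightarrow> weight_ge G n i f"

lemma weight_ge_closed:
  assumes n: "lie_subalgebra n" and "weight_ge G n j f"
  shows "f \<in> carrier (free_algebra n)"
  using assms(2)
  by induct (auto intro!: add_free_algebra mult_free_algebra single_free_algebra intro: env_ideal_closed(1)[OF n])

lemma weight_ge_scalar_mult:
  assumes n: "lie_subalgebra n" and "weight_ge G n j f"
  shows "weight_ge G n j (Poly_Mapping.single [] c * f)"
  using assms(2)
proof induct
  case (ideal f j)
  then show ?case by (auto intro!: weight_ge.ideal env_ideal_closed(6)[OF n] single_free_algebra)
next
  case (letter x i j f)
  have "Poly_Mapping.single [] c * (word [x] * f) = word [x] * (Poly_Mapping.single [] c * f)"
    by (metis mult.assoc single_Nil_commute)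
  with letter show ?case by (auto intro: weight_ge.letter)
qed (auto intro: weight_ge.intros simp: distrib_left)

text \<open>Each term of the Leibniz rule replaces one letter by its bracket with \<open>z\<close>,
  which raises the weight of that letter by \<open>a\<close>.\<close>

lemma weight_ge_derivation:
  assumes n: "lie_subalgebra n" and zn: "\<And>x. x \<in> n \<Longrightarrow> bracket z x \<in> n"
    and zG: "\<And>x i. x \<in> n \<Longrightarrow> x \<in> G i \<Longrightarrow> bracket z x \<in> G (a + i)"
    and "weight_ge G n j f"
  shows "weight_ge G n (a + j) (free_derivation bracket z f)"
  using assms(4)
proof induct
  case (ideal f j)
  then show ?case by (intro weight_ge.ideal free_derivation_env_ideal n zn)
next
  case (scalar c)
  show ?case using env_ideal_closed(2)[OF n] by (simp add: weight_ge.ideal)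
next
  case (add j f g)
  then show ?case by (simp add: free_derivation_add weight_ge.add)
next
  case (letter x i j f)
  have 1: "weight_ge G n ((a + i) + j) (word [bracket z x] * f)"
    using letter zn zG by (intro weight_ge.letter)
  have 2: "weight_ge G n (i + (a + j)) (word [x] * free_derivation bracket z f)"
    using letter by (intro weight_ge.letter)
  show ?case using weight_ge.add[OF 1[unfolded add.assoc] 2[unfolded add.left_commute[of i]]]
    by (simp add: free_derivation_mult)
next
  case (mono j f i)
  then show ?case using weight_ge.mono[of G n "a + j" _ "a + i"] by simp
qed

text \<open>\<psi> kills every letter of weight above \<open>a\<close>, so total weight above
  \<open>a\<close> cannot come from a single surviving letter. This is the divisibility by the
  square of t.\<close>

lemma weight_ge_free_linear_part:
  assumes n: "lie_subalgebra n"
    and add: "\<And>x y. \<psi> (x + y) = \<psi> x + \<psi> y" and scale: "\<And>c x. \<psi> (scale c x) = c * \<psi> x"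
    and bracket: "\<And>x y. x \<in> n \<Longrightarrow> y \<in> n \<Longrightarrow> \<psi> (bracket x y) = 0"
    and G: "\<And>x i. a < i \<Longrightarrow> x \<in> G i \<Longrightarrow> \<psi> x = 0"
    and "weight_ge G n j f"
  shows "(0 < j \<longrightarrow> Poly_Mapping.lookup f [] = 0) \<and> (a < j \<longrightarrow> free_linear_part \<psi> f = 0)"
  using assms(6)
proof induct
  case (ideal f j)
  then show ?case using free_linear_part_env_ideal[OF n _ add scale bracket] by simp
next
  case (letter x i j f)
  \<comment> \<open>If i + j exceeds \<open>a\<close>, then either \<psi> kills the letter, or i
    \<le> a makes \<open>j\<close> positive and the other factor has no constant term.\<close>
  then show ?case using G[of i x]
    by (cases "a < i") (auto simp: lookup_Nil_mult free_linear_part_mult free_linear_part_single lookup_single)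
qed (auto simp: lookup_add free_linear_part_add)

text \<open>\<psi> is the coordinate at \<open>x\<close> with respect to a basis that extends a
  basis of \<open>W\<close> together with \<open>x\<close>.\<close>

lemma exists_linear_functional:
  assumes W: "subspace W" and x: "x \<notin> W"
  obtains \<psi> :: "'g \<Rightarrow> complex" where "\<And>a b. \<psi> (a + b) = \<psi> a + \<psi> b" "\<And>c a. \<psi> (scale c a) = c * \<psi> a"
    "\<psi> x = 1" "\<And>w. w \<in> W \<Longrightarrow> \<psi> w = 0"
proof -
  obtain B where B: "B \<subseteq> W" "independent B" "W \<subseteq> span B"
    using maximal_independent_subset[of W] by blast
  have "span B \<subseteq> W" by (rule span_minimal[OF B(1) W])
  then have "x \<notin> span B" using x by blast
  then have ind: "independent (insert x B)" using B(2) by (simp add: independent_insert)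
  define C where "C = extend_basis (insert x B)"
  have C: "independent C" "insert x B \<subseteq> C" "span C = UNIV"
    unfolding C_def using ind by (rule independent_extend_basis extend_basis_superset span_extend_basis)+
  show thesis
  proof (rule that[of "\<lambda>y. representation C y x"])
    fix w assume "w \<in> W"
    then have "w \<in> span B" using B by blast
    then have "representation C w = representation B w" using representation_extend[OF C(1)] C(2) by blast
    moreover have "representation B w x = 0"
      using representation_ne_zero[of B w x] B(1) x by blast
    ultimately show "representation C w x = 0" by simp
  qed (use C in \<open>auto simp: representation_add representation_scale representation_basis\<close>)
qed

end

section \<open>The action of \<open>U(s)\<close> on \<open>U(m)\<close> and its effect on
  weights\<close>

context split_lie_algebra begin

text \<open>The last letter of a word acts first, so that products act by composition.\<close>

definition free_algebra_action :: "('g list \<Rightarrow>\<^sub>0 complex) \<Rightarrow> ('g list \<Rightarrow>\<^sub>0 complex) \<Rightarrow> ('g list \<Rightarrow>\<^sub>0 complex)" where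
  "free_algebra_action f g = linear_extension (\<lambda>w c. Poly_Mapping.single [] c * foldr free_action w g) f"

lemma free_algebra_action_add: "free_algebra_action (f + f') g = free_algebra_action f g + free_algebra_action f' g"
  unfolding free_algebra_action_def by (rule linear_extension_add) (simp_all add: single_add distrib_right)

lemma free_algebra_action_diff: "free_algebra_action (f - f') g = free_algebra_action f g - free_algebra_action f' g"
  using free_algebra_action_add[of "f - f'" f' g] by (simp add: algebra_simps)

lemma free_algebra_action_single:
  "free_algebra_action (Poly_Mapping.single w c) g = Poly_Mapping.single [] c * foldr free_action w g"
  unfolding free_algebra_action_def by (rule linear_extension_single) simp

lemma free_algebra_action_letter: "free_algebra_action (word [x] * f) g = free_action x (free_algebra_action f g)"
proof (induct f rule: poly_mapping_single_induct)
  case (1 w c)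
  have "word [x] * Poly_Mapping.single w c = Poly_Mapping.single (x # w) c" by (simp add: mult_single plus_list_def)
  then show ?case by (simp add: free_algebra_action_single free_action_scalar)
qed (simp add: distrib_left free_algebra_action_add free_action_add)

lemma free_algebra_action_scalar:
  "free_algebra_action (Poly_Mapping.single [] c * f) g = Poly_Mapping.single [] c * free_algebra_action f g"
proof (induct f rule: poly_mapping_single_induct)
  case (1 w d)
  have "Poly_Mapping.single [] (c * d) = Poly_Mapping.single [] c * Poly_Mapping.single [] d"
    by (simp add: mult.commute)
  then show ?case by (metis single_Nil_mult_single(1) free_algebra_action_single mult.assoc)
qed (simp add: distrib_left free_algebra_action_add)

lemma free_algebra_action_mult: "free_algebra_action (f * f') g = free_algebra_action f (free_algebra_action f' g)"
proof -
  \<comment> \<open>The carrier over all letters is the whole type, so the induction reaches an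
    arbitrary \<open>f\<close>.\<close>
  have "f \<in> carrier (free_algebra UNIV)" by (auto simp: free_algebra_def)
  then show ?thesis
    by (induct f rule: free_algebra_induct)
      (simp_all add: free_algebra_action_scalar free_algebra_action_letter free_algebra_action_add
        distrib_right mult.assoc free_algebra_action_single)
qed

lemma free_algebra_action_closed:
  assumes "f \<in> carrier (free_algebra s)" "g \<in> carrier (free_algebra m)"
  shows "free_algebra_action f g \<in> carrier (free_algebra m)"
  using assms(1)
  by (induct f rule: free_algebra_induct)
    (simp_all add: free_algebra_action_single free_algebra_action_letter free_algebra_action_add assms(2)
      free_action_closed add_free_algebra mult_free_algebra single_free_algebra)

lemma free_algebra_action_env_ideal:
  assumes "f \<in> carrier (free_algebra s)" "g \<in> env_ideal m"
  shows "free_algebra_action f g \<in> env_ideal m"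
  using assms(1)
proof (induct f rule: free_algebra_induct)
  case (scalar c)
  show ?case using assms(2) single_free_algebra[of "[]" m c]
    by (simp add: free_algebra_action_single env_ideal_closed(6)[OF m])
qed (simp_all add: free_algebra_action_letter free_algebra_action_add free_action_env_ideal env_ideal_closed(3)[OF m])

text \<open>Together with \<open>free_algebra_action_env_ideal\<close> this makes
  \<open>U(s)\<close> act on \<open>U(m)\<close>. The three families of relations amount to
  \<open>free_action_plus\<close>, \<open>free_action_scale\<close> and
  \<open>free_action_bracket\<close>.\<close>

lemma env_ideal_action:
  assumes "f \<in> env_ideal s" "g \<in> carrier (free_algebra m)"
  shows "free_algebra_action f g \<in> env_ideal m"
  using s assms
\<comment> \<open>\<open>g\<close> is generalised for the case \<open>right\<close>, where the right
  factor acts on \<open>g\<close> before the induction hypothesis applies.\<close>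
proof (induct f arbitrary: g rule: env_ideal_induct)
  case (plus x y)
  then show ?case using free_action_plus by (simp add: free_algebra_action_diff free_algebra_action_single)
next
  case (scale c x)
  then show ?case using free_action_scale by (simp add: free_algebra_action_diff free_algebra_action_single)
next
  case (bracket x y)
  have "- (free_action (bracket x y) g - (free_action x (free_action y g) - free_action y (free_action x g))) \<in> env_ideal m"
    using bracket by (intro env_ideal_closed(4)[OF m] free_action_bracket)
  then show ?case by (simp add: free_algebra_action_diff free_algebra_action_letter free_algebra_action_single)
next
  case zero
  show ?case using env_ideal_closed(2)[OF m] by (simp add: free_algebra_action_def linear_extension_def)
next
  case (add f f')
  then show ?case by (simp add: free_algebra_action_add env_ideal_closed(3)[OF m])
next
  case (left f h)
  then show ?case by (simp add: free_algebra_action_mult free_algebra_action_env_ideal)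
next
  case (right f h)
  then show ?case by (simp add: free_algebra_action_mult free_algebra_action_closed)
qed

text \<open>Both components of a letter of weight i stay in \<open>G i\<close>. The derivation by
  \<pi> y then raises weights by i because brackets add weights, and left multiplication by y -
  \<pi> y does so by definition.\<close>

lemma weight_ge_action:
  assumes proj_G: "\<And>y i. y \<in> s \<Longrightarrow> y \<in> G i \<Longrightarrow> \<pi> y \<in> G i" and diff_G: "\<And>y i. y \<in> s \<Longrightarrow> y \<in> G i \<Longrightarrow> y - \<pi> y \<in> G i"
    and bracket_G: "\<And>x y i j. x \<in> G i \<Longrightarrow> y \<in> G j \<Longrightarrow> bracket x y \<in> G (i + j)"
    and f: "weight_ge G s i f" and g: "weight_ge G m j g"
  shows "weight_ge G m (i + j) (free_algebra_action f g)"
  using f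
proof induct
  case (ideal f i)
  then show ?case by (intro weight_ge.ideal env_ideal_action weight_ge_closed[OF m g])
next
  case (scalar c)
  show ?case using weight_ge_scalar_mult[OF m g] by (simp add: free_algebra_action_single)
next
  case (add i f f')
  then show ?case by (simp add: free_algebra_action_add weight_ge.add)
next
  case (letter y i i' f)
  let ?h = "free_algebra_action f g"
  have "weight_ge G m (i + (i' + j)) (free_derivation bracket (\<pi> y) ?h)"
    using letter by (intro weight_ge_derivation m proj_bracket_in bracket_G proj_G)
  moreover have "weight_ge G m (i + (i' + j)) (word [y - \<pi> y] * ?h)"
    using letter by (intro weight_ge.letter diff_in diff_G)
  ultimately show ?case by (simp add: free_algebra_action_letter free_action_def weight_ge.add add.assoc)
next
  case (mono i' f i)
  then show ?case using weight_ge.mono[of G m "i' + j" _ "i + j"] by simp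
qed

end

section \<open>Vanishing of letters of high weight\<close>

context lie_algebra begin

text \<open>The filtration \<open>G\<close> stays fixed while \<open>n\<close> shrinks in the
  induction, so the vanishing of \<open>G j\<close> is available for every smaller algebra with the
  same \<open>j\<close>.\<close>

lemma weight_ge_letter_eq_0:
  assumes fd: "finite_dimensional_vector_space scale B"
    and G_subspace: "\<And>i. subspace (G i)" and G_mono: "\<And>i j. i \<le> j \<Longrightarrow> G j \<subseteq> G i"
    and G_bracket: "\<And>x y i j. x \<in> G i \<Longrightarrow> y \<in> G j \<Longrightarrow> bracket x y \<in> G (i + j)"
    and G_vanishes: "G j = {0}"
    and n: "lie_subalgebra n" and n_G: "n \<subseteq> G 1"
    and y: "y \<in> n" and weight: "weight_ge G n j (word [y])"
  shows "y = 0"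
proof -
  interpret fd: finite_dimensional_vector_space scale B by (rule fd)
  show ?thesis using n n_G y weight
  proof (induct "dim n" arbitrary: n y rule: less_induct)
    case (less n)
    note n = less(2)
    show ?case
    proof (rule ccontr)
      assume "y \<noteq> 0"
      then have n0: "\<not> n \<subseteq> G i" if "j \<le> i" for i using less(4) G_mono[OF that] G_vanishes by blast
      \<comment> \<open>The maximum exists because \<open>n\<close> lies in \<open>G 1\<close> and,
        containing the nonzero \<open>y\<close>, in no \<open>G i\<close> with j \<le> i.\<close>
      define a where "a = (GREATEST i. n \<subseteq> G i)"
      have a_bound: "i \<le> j" if "n \<subseteq> G i" for i using n0[of i] that by (meson nle_le)
      have na: "n \<subseteq> G a" unfolding a_def by (rule GreatestI_nat[of _ 1 j]) (use less(3) a_bound in auto)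
      have le_a: "i \<le> a" if "n \<subseteq> G i" for i
        unfolding a_def by (rule Greatest_le_nat[of _ _ j]) (use that a_bound in auto)
      have a: "1 \<le> a" "a < j" using le_a[OF less(3)] n0[of a] na by (blast, metis not_less)
      have "\<not> n \<subseteq> G (Suc a)" using le_a[of "Suc a"] by auto
      then obtain x where x: "x \<in> n" "x \<notin> G (Suc a)" by blast
      \<comment> \<open>\<psi> cuts out \<open>m\<close>: it vanishes on \<open>G (Suc a)\<close>
        but not on \<open>x\<close>, so its kernel in \<open>n\<close> has codimension 1 and
        contains the part of \<open>n\<close> in \<open>G (Suc a)\<close>.\<close>
      obtain \<psi> where add: "\<And>u v. \<psi> (u + v) = \<psi> u + \<psi> v" and scale: "\<And>c u. \<psi> (scale c u) = c * \<psi> u"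
        and \<psi>x: "\<psi> x = 1" and \<psi>G: "\<And>w. w \<in> G (Suc a) \<Longrightarrow> \<psi> w = 0"
        using exists_linear_functional[OF G_subspace x(2)] by blast
      have \<psi>G': "\<psi> w = 0" if "a < i" "w \<in> G i" for w i using G_mono[of "Suc a" i] that \<psi>G by auto
      \<comment> \<open>Brackets of \<open>n\<close> lie in \<open>G (a + a)\<close>, which is
        inside \<open>G (Suc a)\<close> because 1 \<le> a. Hence \<open>m\<close> is an ideal of
        \<open>n\<close>.\<close>
      have \<psi>bracket: "\<psi> (bracket u v) = 0" if "u \<in> n" "v \<in> n" for u v
        using G_bracket[of u a v a] that na a \<psi>G'[of "a + a"] by auto
      have diff: "\<psi> (u - v) = \<psi> u - \<psi> v" for u v using add[of "u - v" v] by simp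
      define m where "m = {u \<in> n. \<psi> u = 0}"
      have m: "lie_subalgebra m" using n add scale \<psi>bracket diff[of 0 0]
        unfolding m_def lie_subalgebra_def subspace_def by auto
      note n_closed = subalgebra_closed[OF n]
      \<comment> \<open>The projection onto the line through \<open>x\<close> respects brackets as
        both sides are 0: \<psi> kills brackets, and \<open>x\<close> commutes with itself.\<close>
      interpret split_lie_algebra scale bracket n m "\<lambda>u. scale (\<psi> u) x"
      proof unfold_locales
        fix u assume u: "u \<in> n"
        show "scale (\<psi> u) x \<in> n" by (intro n_closed x)
        then show "u - scale (\<psi> u) x \<in> m" using u n_closed(5) by (simp add: m_def diff scale \<psi>x)
        show "scale (\<psi> (scale c u)) x = scale c (scale (\<psi> u) x)" for c by (simp add: scale)
        fix v assume v: "v \<in> n"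
        show "scale (\<psi> (u + v)) x = scale (\<psi> u) x + scale (\<psi> v) x" by (simp add: add scale_left_distrib)
        show "scale (\<psi> (bracket u v)) x = bracket (scale (\<psi> u) x) (scale (\<psi> v) x)"
          by (simp add: \<psi>bracket u v bracket_scale_left bracket_scale_right bracket_self)
      next
        fix u v assume "u \<in> n" "v \<in> m"
        then show "bracket u v \<in> m" using n_closed(4) \<psi>bracket by (simp add: m_def)
      qed (rule n m)+
      \<comment> \<open>For i above \<open>a\<close> the projection is 0 by the choice of \<psi>;
        otherwise it lies in \<open>G i\<close> because \<open>x\<close> is in
        \<open>G a\<close>.\<close>
      have proj_G: "scale (\<psi> u) x \<in> G i" if "u \<in> n" "u \<in> G i" for u i
      proof (cases "a < i")
        case True
        then show ?thesis using \<psi>G'[OF True that(2)] G_subspace by (simp add: subspace_0)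
      next
        case False
        then have "x \<in> G i" using G_mono[of i a] na x by auto
        then show ?thesis using G_subspace by (simp add: subspace_scale)
      qed
      have diff_G: "u - scale (\<psi> u) x \<in> G i" if "u \<in> n" "u \<in> G i" for u i
        using subspace_diff[OF G_subspace that(2) proj_G[OF that]] .
      \<comment> \<open>\<open>y\<close> is applied to 1, which has weight 0. The derivation kills
        1, so what remains is the component of \<open>y\<close> in \<open>m\<close>, now of weight
        at least \<open>j\<close> in \<open>U(m)\<close>.\<close>
      have "weight_ge G m (j + 0) (free_algebra_action (word [y]) (Poly_Mapping.single [] 1))"
        by (rule weight_ge_action[OF proj_G diff_G G_bracket less(5) weight_ge.scalar])
      then have weight: "weight_ge G m j (word [y - scale (\<psi> y) x])"
        by (simp add: free_algebra_action_single free_action_def free_derivation_Nil[where c = 1, simplified])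
      have "m \<subseteq> n" "x \<notin> m" using \<psi>x by (auto simp: m_def)
      then have "dim m < dim n"
        using m n x(1) by (intro fd.dim_psubset) (auto simp: lie_subalgebra_def span_eq_iff[THEN iffD2])
      from less(1)[OF this m _ diff_in[OF less(4)] weight] \<open>m \<subseteq> n\<close> less(3)
      have y: "y = scale (\<psi> y) x" by auto
      \<comment> \<open>The remaining component along \<open>x\<close> is read off in the
        polynomials in t, where weight \<open>j\<close> above \<open>a\<close> leaves no linear
        term.\<close>
      have "(0 < j \<longrightarrow> Poly_Mapping.lookup (word [y]) [] = 0) \<and> (a < j \<longrightarrow> free_linear_part \<psi> (word [y]) = 0)"
        by (rule weight_ge_free_linear_part[OF n add scale _ _ less(5)]) (fact \<psi>bracket, fact \<psi>G')
      with a have "free_linear_part \<psi> (word [y]) = 0" by blast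
      then have "\<psi> y = 0" by (simp add: free_linear_part_single)
      with y \<open>y \<noteq> 0\<close> show False by simp
    qed
  qed
qed

end

section \<open>Lower central series\<close>

context lie_algebra begin

lemma lower_central_series_subspace: "lie_subalgebra n \<Longrightarrow> subspace (lower_central_series n i)"
  by (cases i) (simp_all add: lie_subalgebra_def)

lemma lower_central_series_decreasing:
  assumes n: "lie_subalgebra n" and "i \<le> j"
  shows "lower_central_series n j \<subseteq> lower_central_series n i"
proof -
  have "lower_central_series n (Suc i) \<subseteq> lower_central_series n i" for i
  proof (induct i)
    case 0
    have "{bracket x y |x y. x \<in> n \<and> y \<in> n} \<subseteq> n" using subalgebra_closed(4)[OF n] by blast
    then show ?case using n by (simp add: lie_subalgebra_def span_minimal)
  next
    case (Suc i)
    then show ?case unfolding lower_central_series.simps(2)[of n "Suc i"] lower_central_series.simps(2)[of n i]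
      by (intro span_mono) blast
  qed
  with \<open>i \<le> j\<close> show ?thesis by (rule lift_Suc_antimono_le[rotated])
qed

text \<open>Induction on \<open>j\<close> by the Jacobi identity in the form [x,[u,v]] = [[x,u],v] -
  [[x,v],u]. The extra \<open>Suc\<close> comes from giving \<open>n\<close> itself the index
  0.\<close>

lemma lower_central_series_bracket:
  assumes n: "lie_subalgebra n" and "x \<in> lower_central_series n i" "y \<in> lower_central_series n j"
  shows "bracket x y \<in> lower_central_series n (Suc (i + j))"
  using assms(2,3)
proof (induct j arbitrary: i x y)
  case 0
  then show ?case by (auto intro: span_base)
next
  case (Suc j)
  let ?L = "lower_central_series n"
  have step: "bracket u v \<in> ?L (Suc i)" if "u \<in> ?L i" "v \<in> n" for u v i
    using that by (auto intro: span_base)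
  note sub = lower_central_series_subspace[OF n]
  have "span {bracket x y |x y. x \<in> ?L j \<and> y \<in> n} \<subseteq> {y. bracket x y \<in> ?L (Suc (i + Suc j))}"
  proof (rule span_minimal, rule subsetI)
    show "subspace {y. bracket x y \<in> ?L (Suc (i + Suc j))}"
      using sub[of "Suc (i + Suc j)"] unfolding subspace_def by (simp add: bracket_add_right bracket_scale_right)
    fix w assume "w \<in> {bracket x y |x y. x \<in> ?L j \<and> y \<in> n}"
    then obtain u v where uv: "u \<in> ?L j" "v \<in> n" and w: "w = bracket u v" by blast
    have 1: "bracket (bracket x u) v \<in> ?L (Suc (i + Suc j))"
      using step[OF Suc(1)[OF Suc(2) uv(1)] uv(2)] by simp
    have 2: "bracket (bracket x v) u \<in> ?L (Suc (i + Suc j))"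
      using Suc(1)[OF step[OF Suc(2) uv(2)] uv(1)] by simp
    have "bracket x w = bracket (bracket x u) v - bracket (bracket x v) u"
      unfolding w bracket_derivation[of x u v] using bracket_anticommute[of u "bracket x v"] by simp
    then show "w \<in> {y. bracket x y \<in> ?L (Suc (i + Suc j))}"
      using subspace_diff[OF sub 1 2] by simp
  qed
  then show ?case using Suc(3) by auto
qed

text \<open>Bracketing on the right with one more entry is linear, so spanning commutators pass from
  one term to the next.\<close>

lemma lower_central_series_left_commutators:
  "lie_subalgebra n \<Longrightarrow> lower_central_series n i \<subseteq> span {left_commutator bracket xs |xs. length xs = Suc i \<and> set xs \<subseteq> n}"
proof (induct i)
  case 0
  have "x \<in> {left_commutator bracket xs |xs. length xs = Suc 0 \<and> set xs \<subseteq> n}" if "x \<in> n" for x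
    using that by (auto intro!: exI[of _ "[x]"])
  then show ?case by (auto intro: span_base)
next
  case (Suc i)
  let ?C = "\<lambda>i. {left_commutator bracket xs |xs. length xs = Suc i \<and> set xs \<subseteq> n}"
  have "bracket x y \<in> span (?C (Suc i))" if "x \<in> lower_central_series n i" and y: "y \<in> n" for x y
  proof -
    have "span (?C i) \<subseteq> {x. bracket x y \<in> span (?C (Suc i))}"
    proof (rule span_minimal, rule subsetI)
      show "subspace {x. bracket x y \<in> span (?C (Suc i))}"
        unfolding subspace_def by (simp add: bracket_add_left bracket_scale_left span_zero span_add span_scale)
      fix w assume "w \<in> ?C i"
      then obtain xs where xs: "length xs = Suc i" "set xs \<subseteq> n" "w = left_commutator bracket xs" by blast
      then have "bracket w y = left_commutator bracket (xs @ [y])" by (cases xs) simp_all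
      moreover have "length (xs @ [y]) = Suc (Suc i)" "set (xs @ [y]) \<subseteq> n" using xs y by auto
      ultimately have "bracket w y \<in> ?C (Suc i)" by blast
      then show "w \<in> {x. bracket x y \<in> span (?C (Suc i))}" by (simp add: span_base)
    qed
    with Suc that show ?thesis by blast
  qed
  then show ?case by (simp only: lower_central_series.simps) (intro span_minimal, auto)
qed

lemma left_commutator_in_lower_central_series:
  "length xs = Suc i \<Longrightarrow> set xs \<subseteq> n \<Longrightarrow> left_commutator bracket xs \<in> lower_central_series n i"
proof (induct i arbitrary: xs)
  case 0
  then show ?case by (cases xs) auto
next
  case (Suc i)
  then obtain ys y where xs: "xs = ys @ [y]" by (cases xs rule: rev_cases) auto
  with Suc obtain z zs where ys: "ys = z # zs" by (cases ys) auto
  have "left_commutator bracket xs = bracket (left_commutator bracket ys) y" by (simp add: xs ys)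
  with Suc xs show ?case by (auto intro!: span_base)
qed

text \<open>Commutators with \<open>k\<close> entries belong to the term \<open>k - 1\<close>, since
  the series starts at index 0. Nilpotency ensures that the minimum defining \<open>k\<close> is
  attained.\<close>

lemma lower_central_series_vanishes:
  assumes n: "lie_subalgebra n" and nil: "lie_nilpotent n"
    and k: "k = (LEAST m. 0 < m \<and> (\<forall>xs. length xs = m \<and> set xs \<subseteq> n \<longrightarrow> left_commutator bracket xs = 0))"
  shows "lower_central_series n (k - 1) = {0}"
proof -
  let ?P = "\<lambda>m. 0 < m \<and> (\<forall>xs. length xs = m \<and> set xs \<subseteq> n \<longrightarrow> left_commutator bracket xs = 0)"
  obtain i where "lower_central_series n i = {0}" using nil by (auto simp: lie_nilpotent_def)
  then have "?P (Suc i)" using left_commutator_in_lower_central_series[of _ i n] by auto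
  then have "?P k" unfolding k by (rule LeastI)
  then obtain j where "k = Suc j" and j: "\<forall>xs. length xs = Suc j \<and> set xs \<subseteq> n \<longrightarrow> left_commutator bracket xs = 0"
    by (cases k) auto
  then have "{left_commutator bracket xs |xs. length xs = Suc j \<and> set xs \<subseteq> n} \<subseteq> {0}" by auto
  then have "span {left_commutator bracket xs |xs. length xs = Suc j \<and> set xs \<subseteq> n} \<subseteq> {0}"
    by (rule span_minimal) simp
  with lower_central_series_left_commutators[OF n, of j] subspace_0[OF lower_central_series_subspace[OF n]]
  show ?thesis unfolding \<open>k = Suc j\<close> by fastforce
qed

end

section \<open>Quotients of complex vector spaces and of modules\<close>

lemma complex_field_simps [simp]:
  "carrier complex_field = UNIV" "x \<otimes>\<^bsub>complex_field\<^esub> y = x * y" "x \<oplus>\<^bsub>complex_field\<^esub> y = x + y"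
  "\<one>\<^bsub>complex_field\<^esub> = 1" "\<zero>\<^bsub>complex_field\<^esub> = 0"
  by (simp_all add: complex_field_def)

lemma cring_complex_field: "cring complex_field"
proof (rule cringI, rule abelian_groupI)
  show "\<exists>y\<in>carrier complex_field. y \<oplus>\<^bsub>complex_field\<^esub> x = \<zero>\<^bsub>complex_field\<^esub>" for x
    by (rule bexI[of _ "- x"]) simp_all
qed (auto intro!: comm_monoidI simp: algebra_simps)

lemma uminus_complex_field: "\<ominus>\<^bsub>complex_field\<^esub> x = - x"
proof -
  interpret cring complex_field by (rule cring_complex_field)
  show ?thesis by (rule minus_equality) simp_all
qed

lemma complex_submoduleI:
  assumes M: "Module.module complex_field M" and W: "W \<subseteq> carrier M" "\<zero>\<^bsub>M\<^esub> \<in> W"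
    and add: "\<And>v w. v \<in> W \<Longrightarrow> w \<in> W \<Longrightarrow> v \<oplus>\<^bsub>M\<^esub> w \<in> W" and smult: "\<And>c v. v \<in> W \<Longrightarrow> c \<odot>\<^bsub>M\<^esub> v \<in> W"
  shows "submodule W complex_field M"
proof -
  interpret Module.module complex_field M by (rule M)
  have "\<ominus>\<^bsub>M\<^esub> v \<in> W" if "v \<in> W" for v
  proof -
    have "v \<in> carrier M" using that W by blast
    then show ?thesis
      using smult[OF that, of "- 1"] smult_l_minus[of 1 v] smult_one[of v] by (simp add: uminus_complex_field)
  qed
  then show ?thesis
    using W add smult by (auto intro!: submoduleI)
qed

lemma submoduleD:
  assumes M: "Module.module complex_field M" and W: "submodule W complex_field M"
  shows "W \<subseteq> carrier M" "\<zero>\<^bsub>M\<^esub> \<in> W" "v \<in> W \<Longrightarrow> w \<in> W \<Longrightarrow> v \<oplus>\<^bsub>M\<^esub> w \<in> W" "v \<in> W \<Longrightarrow> c \<odot>\<^bsub>M\<^esub> v \<in> W"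
  using module.submoduleE(1,5)[OF M W] submodule.smult_closed[OF W, of c] submodule.axioms(1)[OF W]
  by (auto simp: subgroup_def)

lemma submodule_carrier:
  assumes "Module.module complex_field M"
  shows "submodule (carrier M) complex_field M"
proof -
  interpret Module.module complex_field M by (rule assms)
  show ?thesis by (rule complex_submoduleI[OF assms]) auto
qed

lemma lin_span_submodule:
  assumes M: "Module.module complex_field M" and S: "S \<subseteq> carrier M"
  shows "submodule (lin_span M S) complex_field M"
proof (rule complex_submoduleI[OF M])
  show "lin_span M S \<subseteq> carrier M" using submodule_carrier[OF M] S by (auto simp: lin_span_def)
  show "\<zero>\<^bsub>M\<^esub> \<in> lin_span M S" by (auto simp: lin_span_def submoduleD(2)[OF M])
  show "v \<oplus>\<^bsub>M\<^esub> w \<in> lin_span M S" if "v \<in> lin_span M S" "w \<in> lin_span M S" for v w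
    using that by (auto simp: lin_span_def submoduleD(3)[OF M])
  show "c \<odot>\<^bsub>M\<^esub> v \<in> lin_span M S" if "v \<in> lin_span M S" for c v
    using that by (auto simp: lin_span_def submoduleD(4)[OF M])
qed

lemma lin_span_superset: "S \<subseteq> lin_span M S"
  by (auto simp: lin_span_def)

lemma lin_span_minimal: "submodule W complex_field M \<Longrightarrow> S \<subseteq> W \<Longrightarrow> lin_span M S \<subseteq> W"
  by (auto simp: lin_span_def)

lemma (in abelian_subgroup) a_rcos_eq_iff:
  assumes "x \<in> carrier G" "y \<in> carrier G"
  shows "H +> x = H +> y \<longleftrightarrow> x \<ominus> y \<in> H"
proof -
  have "H +> x = H +> y \<longleftrightarrow> x \<in> H +> y"
    using a_rcos_self[OF assms(1)] a_repr_independence[OF _ assms(2) a_subgroup] by auto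
  then show ?thesis using a_rcos_module[OF assms(2,1)] by (simp add: a_minus_def)
qed

text \<open>\<open>coset_map\<close> is a union over all representatives; by additivity and
  invariance of \<open>H\<close> they all contribute the same coset.\<close>

lemma (in abelian_subgroup) coset_map_a_rcos:
  assumes closed: "\<And>x. x \<in> carrier G \<Longrightarrow> T x \<in> carrier G"
    and add: "\<And>x y. x \<in> carrier G \<Longrightarrow> y \<in> carrier G \<Longrightarrow> T (x \<oplus> y) = T x \<oplus> T y"
    and H: "\<And>x. x \<in> H \<Longrightarrow> T x \<in> H" and x: "x \<in> carrier G"
  shows "coset_map G H T (H +> x) = H +> T x"
proof -
  have "H +> T x' = H +> T x" if "x' \<in> H +> x" for x'
  proof -
    obtain h where h: "h \<in> H" "x' = h \<oplus> x" using \<open>x' \<in> H +> x\<close> by (auto simp: a_r_coset_def')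
    then have "T x' \<in> H +> T x" using H h x a_subset add[of h x] by (auto simp: a_r_coset_def')
    then show ?thesis using a_repr_independence[OF _ closed[OF x] a_subgroup] by simp
  qed
  moreover have "x \<in> H +> x" by (rule a_rcos_self[OF x])
  ultimately show ?thesis unfolding coset_map_def by blast
qed

lemma submodule_abelian_subgroup:
  assumes "Module.module complex_field M" "submodule W complex_field M"
  shows "abelian_subgroup W M"
proof -
  interpret Module.module complex_field M by (rule assms(1))
  show ?thesis using submodule.axioms(1)[OF assms(2)]
    by (intro abelian_subgroupI3 additive_subgroup.intro M.abelian_group_axioms)
qed

text \<open>The axioms pass along a surjection that respects the operations. This serves both
  passages to cosets, from the free algebra to \<open>U(n)\<close> and from a module to
  \<open>quotient_space\<close>.\<close>

lemma module_image:
  assumes M: "Module.module complex_field M" and carrier: "carrier N = q ` carrier M"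
    and add: "\<And>v w. v \<in> carrier M \<Longrightarrow> w \<in> carrier M \<Longrightarrow> q v \<oplus>\<^bsub>N\<^esub> q w = q (v \<oplus>\<^bsub>M\<^esub> w)"
    and smult: "\<And>c v. v \<in> carrier M \<Longrightarrow> c \<odot>\<^bsub>N\<^esub> q v = q (c \<odot>\<^bsub>M\<^esub> v)"
    and zero: "\<zero>\<^bsub>N\<^esub> = q \<zero>\<^bsub>M\<^esub>"
  shows "Module.module complex_field N"
proof -
  interpret Module.module complex_field M by (rule M)
  have N: "abelian_group N"
  proof (rule abelian_groupI)
    fix x assume "x \<in> carrier N"
    then obtain v where v: "v \<in> carrier M" "x = q v" by (auto simp: carrier)
    then have "q (\<ominus>\<^bsub>M\<^esub> v) \<oplus>\<^bsub>N\<^esub> x = \<zero>\<^bsub>N\<^esub>" by (simp add: add zero M.l_neg)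
    with v show "\<exists>y\<in>carrier N. y \<oplus>\<^bsub>N\<^esub> x = \<zero>\<^bsub>N\<^esub>" by (auto simp: carrier)
  qed (auto simp: carrier add zero M.a_ac)
  show ?thesis
    using smult_l_distr smult_assoc1 smult_one
    by (intro moduleI cring_complex_field N) (auto simp: carrier add smult smult_r_distr)
qed

lemma lie_module_image:
  assumes M: "lie_module scale bracket M act" and carrier: "carrier N = q ` carrier M"
    and add: "\<And>v w. v \<in> carrier M \<Longrightarrow> w \<in> carrier M \<Longrightarrow> q v \<oplus>\<^bsub>N\<^esub> q w = q (v \<oplus>\<^bsub>M\<^esub> w)"
    and smult: "\<And>c v. v \<in> carrier M \<Longrightarrow> c \<odot>\<^bsub>N\<^esub> q v = q (c \<odot>\<^bsub>M\<^esub> v)"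
    and zero: "\<zero>\<^bsub>N\<^esub> = q \<zero>\<^bsub>M\<^esub>"
    and act: "\<And>x v. v \<in> carrier M \<Longrightarrow> act' x (q v) = q (act x v)"
  shows "lie_module scale bracket N act'"
proof -
  have mM: "Module.module complex_field M" using M by (simp add: lie_module_def)
  interpret Module.module complex_field M by (rule mM)
  have mN: "Module.module complex_field N" by (rule module_image[OF mM carrier add smult zero])
  interpret N: Module.module complex_field N by (rule mN)
  have neg: "\<ominus>\<^bsub>N\<^esub> q v = q (\<ominus>\<^bsub>M\<^esub> v)" if "v \<in> carrier M" for v
    using that by (intro N.M.minus_equality) (auto simp: carrier add zero M.l_neg)
  have minus: "q v \<ominus>\<^bsub>N\<^esub> q w = q (v \<ominus>\<^bsub>M\<^esub> w)" if "v \<in> carrier M" "w \<in> carrier M" for v w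
    using that by (simp add: a_minus_def neg add)
  show ?thesis using M mN unfolding lie_module_def
    by (auto simp: carrier add smult act minus)
qed

lemma quotient_space_simps:
  assumes M: "Module.module complex_field M" and W: "submodule W complex_field M"
  shows "carrier (quotient_space M W) = (\<lambda>v. W +>\<^bsub>M\<^esub> v) ` carrier M"
    and "v \<in> carrier M \<Longrightarrow> w \<in> carrier M \<Longrightarrow>
      (W +>\<^bsub>M\<^esub> v) \<oplus>\<^bsub>quotient_space M W\<^esub> (W +>\<^bsub>M\<^esub> w) = W +>\<^bsub>M\<^esub> (v \<oplus>\<^bsub>M\<^esub> w)"
    and "v \<in> carrier M \<Longrightarrow> c \<odot>\<^bsub>quotient_space M W\<^esub> (W +>\<^bsub>M\<^esub> v) = W +>\<^bsub>M\<^esub> (c \<odot>\<^bsub>M\<^esub> v)"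
    and "\<zero>\<^bsub>quotient_space M W\<^esub> = W +>\<^bsub>M\<^esub> \<zero>\<^bsub>M\<^esub>"
proof -
  interpret Module.module complex_field M by (rule M)
  interpret W: abelian_subgroup W M by (rule submodule_abelian_subgroup[OF M W])
  show "carrier (quotient_space M W) = (\<lambda>v. W +>\<^bsub>M\<^esub> v) ` carrier M"
    by (auto simp: quotient_space_def A_RCOSETS_def')
  show "v \<in> carrier M \<Longrightarrow> w \<in> carrier M \<Longrightarrow>
      (W +>\<^bsub>M\<^esub> v) \<oplus>\<^bsub>quotient_space M W\<^esub> (W +>\<^bsub>M\<^esub> w) = W +>\<^bsub>M\<^esub> (v \<oplus>\<^bsub>M\<^esub> w)"
    by (simp add: quotient_space_def W.a_rcos_sum)
  show "c \<odot>\<^bsub>quotient_space M W\<^esub> (W +>\<^bsub>M\<^esub> v) = W +>\<^bsub>M\<^esub> (c \<odot>\<^bsub>M\<^esub> v)" if "v \<in> carrier M"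
  proof -
    have "coset_map M W (smult M c) (W +>\<^bsub>M\<^esub> v) = W +>\<^bsub>M\<^esub> (c \<odot>\<^bsub>M\<^esub> v)"
      by (rule W.coset_map_a_rcos) (simp_all add: smult_r_distr submoduleD(4)[OF M W] that)
    then show ?thesis by (simp add: quotient_space_def)
  qed
  have "W +>\<^bsub>M\<^esub> \<zero>\<^bsub>M\<^esub> = W" by (rule M.a_coset_add_zero[OF submoduleD(1)[OF M W]])
  then show "\<zero>\<^bsub>quotient_space M W\<^esub> = W +>\<^bsub>M\<^esub> \<zero>\<^bsub>M\<^esub>" by (simp add: quotient_space_def)
qed

lemma quotient_space_module:
  assumes "Module.module complex_field M" "submodule W complex_field M"
  shows "Module.module complex_field (quotient_space M W)"
  using assms(1) quotient_space_simps[OF assms] by (rule module_image)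

lemma coset_map_lie_action:
  assumes W: "lie_submodule scale bracket M act W" and v: "v \<in> carrier M"
  shows "coset_map M W (act x) (W +>\<^bsub>M\<^esub> v) = W +>\<^bsub>M\<^esub> act x v"
proof -
  interpret abelian_subgroup W M
    using W by (auto simp: lie_submodule_def lie_module_def intro: submodule_abelian_subgroup)
  show ?thesis using W v by (intro coset_map_a_rcos) (auto simp: lie_submodule_def lie_module_def)
qed

lemma lie_module_quotient:
  assumes W: "lie_submodule scale bracket M act W"
  shows "lie_module scale bracket (quotient_space M W) (\<lambda>x. coset_map M W (act x))"
proof -
  have M: "lie_module scale bracket M act" "Module.module complex_field M" "submodule W complex_field M"
    using W by (auto simp: lie_submodule_def lie_module_def)
  show ?thesis
    using M(1) quotient_space_simps[OF M(2,3)] coset_map_lie_action[OF W] by (rule lie_module_image)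
qed

section \<open>The enveloping algebra and the action\<close>

lemma module_free_algebra: "Module.module complex_field (free_algebra n)"
proof (rule moduleI)
  show "abelian_group (free_algebra n)" by (rule ring.is_abelian_group[OF ring_free_algebra])
  fix a x assume x: "x \<in> carrier (free_algebra n)"
  show "a \<odot>\<^bsub>free_algebra n\<^esub> x \<in> carrier (free_algebra n)"
    unfolding smult_free_algebra using x by (intro mult_free_algebra single_free_algebra) auto
  fix b
  show "(a \<otimes>\<^bsub>complex_field\<^esub> b) \<odot>\<^bsub>free_algebra n\<^esub> x = a \<odot>\<^bsub>free_algebra n\<^esub> (b \<odot>\<^bsub>free_algebra n\<^esub> x)"
    by (simp add: smult_free_algebra mult.assoc[symmetric] mult.commute)
qed (auto simp: cring_complex_field smult_free_algebra single_add algebra_simps)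

section \<open>Computing in \<open>U(n)\<close> with representatives\<close>

context lie_algebra begin

abbreviation env_coset :: "'g set \<Rightarrow> ('g list \<Rightarrow>\<^sub>0 complex) \<Rightarrow> ('g list \<Rightarrow>\<^sub>0 complex) set" where
  "env_coset n f \<equiv> env_ideal n +>\<^bsub>free_algebra n\<^esub> f"

text \<open>This is the scaling relation with factor 0. The letter 0 is a nonzero element of the
  free algebra and vanishes only in \<open>U(n)\<close>.\<close>

lemma word_zero_env_ideal: "lie_subalgebra n \<Longrightarrow> word [0] \<in> env_ideal n"
  using env_ideal_relations(2)[of n 0 0] subalgebra_closed(1)[of n] by simp

lemma env_coset_eq_iff:
  assumes n: "lie_subalgebra n" and f: "f \<in> carrier (free_algebra n)" "g \<in> carrier (free_algebra n)"
  shows "env_coset n f = env_coset n g \<longleftrightarrow> f - g \<in> env_ideal n"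
proof -
  interpret J: ideal "env_ideal n" "free_algebra n" by (rule env_ideal_ideal[OF n])
  show ?thesis using J.a_rcos_eq_iff[OF f] uminus_free_algebra[OF f(2)] by (simp add: a_minus_def)
qed

lemma enveloping_algebra_simps:
  assumes n: "lie_subalgebra n"
  shows "carrier (enveloping_algebra scale bracket n) = env_coset n ` carrier (free_algebra n)"
    and "f \<in> carrier (free_algebra n) \<Longrightarrow> g \<in> carrier (free_algebra n) \<Longrightarrow>
      env_coset n f \<oplus>\<^bsub>enveloping_algebra scale bracket n\<^esub> env_coset n g = env_coset n (f + g)"
    and "f \<in> carrier (free_algebra n) \<Longrightarrow> g \<in> carrier (free_algebra n) \<Longrightarrow>
      env_coset n f \<otimes>\<^bsub>enveloping_algebra scale bracket n\<^esub> env_coset n g = env_coset n (f * g)"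
    and "f \<in> carrier (free_algebra n) \<Longrightarrow>
      c \<odot>\<^bsub>enveloping_algebra scale bracket n\<^esub> env_coset n f = env_coset n (Poly_Mapping.single [] c * f)"
    and "\<zero>\<^bsub>enveloping_algebra scale bracket n\<^esub> = env_coset n 0"
    and "\<one>\<^bsub>enveloping_algebra scale bracket n\<^esub> = env_coset n 1"
proof -
  interpret J: ideal "env_ideal n" "free_algebra n" by (rule env_ideal_ideal[OF n])
  note defs = enveloping_algebra_def Let_def FactRing_def ring.defs module.defs
  show "carrier (enveloping_algebra scale bracket n) = env_coset n ` carrier (free_algebra n)"
    by (auto simp: defs A_RCOSETS_def')
  show "f \<in> carrier (free_algebra n) \<Longrightarrow> g \<in> carrier (free_algebra n) \<Longrightarrow>
      env_coset n f \<oplus>\<^bsub>enveloping_algebra scale bracket n\<^esub> env_coset n g = env_coset n (f + g)"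
    by (simp add: defs J.a_rcos_sum)
  show "f \<in> carrier (free_algebra n) \<Longrightarrow> g \<in> carrier (free_algebra n) \<Longrightarrow>
      env_coset n f \<otimes>\<^bsub>enveloping_algebra scale bracket n\<^esub> env_coset n g = env_coset n (f * g)"
    by (simp add: defs J.rcoset_mult_add)
  show "c \<odot>\<^bsub>enveloping_algebra scale bracket n\<^esub> env_coset n f = env_coset n (Poly_Mapping.single [] c * f)"
    if f: "f \<in> carrier (free_algebra n)"
  proof -
    have "coset_map (free_algebra n) (env_ideal n) (smult (free_algebra n) c) (env_coset n f) =
      env_coset n (c \<odot>\<^bsub>free_algebra n\<^esub> f)"
      using f by (intro J.coset_map_a_rcos)
        (auto simp: smult_free_algebra distrib_left intro!: mult_free_algebra single_free_algebra env_ideal_closed(6)[OF n])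
    then show ?thesis by (simp add: defs smult_free_algebra)
  qed
  have "env_coset n 0 = env_ideal n"
    using J.a_coset_add_zero[OF J.a_subset] by simp
  then show "\<zero>\<^bsub>enveloping_algebra scale bracket n\<^esub> = env_coset n 0" by (simp add: defs)
  show "\<one>\<^bsub>enveloping_algebra scale bracket n\<^esub> = env_coset n 1" by (simp add: defs)
qed

lemma module_enveloping_algebra:
  assumes n: "lie_subalgebra n"
  shows "Module.module complex_field (enveloping_algebra scale bracket n)"
  by (rule module_image[OF module_free_algebra enveloping_algebra_simps(1)[OF n]])
    (simp_all add: enveloping_algebra_simps[OF n] smult_free_algebra)

lemma long_products_span_submodule:
  assumes n: "lie_ideal n"
  shows "submodule (long_products_span scale bracket n k) complex_field (enveloping_algebra scale bracket n)"
  unfolding long_products_span_def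
  by (intro lin_span_submodule module_enveloping_algebra lie_ideal_subalgebra[OF n])
    (auto simp: env_prod_word[OF n] enveloping_algebra_simps(1)[OF lie_ideal_subalgebra[OF n]]
      intro!: imageI single_free_algebra)

lemma word_in_long_products_span:
  assumes n: "lie_ideal n" and "set xs \<subseteq> n" "length xs > k"
  shows "env_coset n (word xs) \<in> long_products_span scale bracket n k"
  unfolding long_products_span_def
  using assms(3) env_prod_word[OF assms(1,2)] assms(2)
  by (intro subsetD[OF lin_span_superset] CollectI exI[of _ xs]) simp

text \<open>Letters of \<open>n\<close> have weight at least 1 because \<open>n\<close> lies in
  \<open>G 1\<close>, so a product of more than \<open>k\<close> of them has weight at least
  \<open>Suc k\<close>. Classes of that weight form a subspace.\<close>

lemma long_products_span_weight:
  assumes n: "lie_ideal n" and G: "n \<subseteq> G 1" and u: "u \<in> long_products_span scale bracket n k"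
  shows "\<exists>f. weight_ge G n (Suc k) f \<and> u = env_coset n f"
proof -
  let ?U = "enveloping_algebra scale bracket n" and ?W = "{env_coset n f |f. weight_ge G n (Suc k) f}"
  have n': "lie_subalgebra n" by (rule lie_ideal_subalgebra[OF n])
  note closed = weight_ge_closed[OF n']
  have "submodule ?W complex_field ?U"
  proof (rule complex_submoduleI[OF module_enveloping_algebra[OF n']])
    show "?W \<subseteq> carrier ?U" using closed by (auto simp: enveloping_algebra_simps(1)[OF n'])
    show "\<zero>\<^bsub>?U\<^esub> \<in> ?W"
      using weight_ge.ideal[OF env_ideal_closed(2)[OF n']] by (auto simp: enveloping_algebra_simps(5)[OF n'])
    show "v \<oplus>\<^bsub>?U\<^esub> w \<in> ?W" if "v \<in> ?W" "w \<in> ?W" for v w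
    proof -
      obtain f g where f: "weight_ge G n (Suc k) f" "v = env_coset n f" and g: "weight_ge G n (Suc k) g" "w = env_coset n g"
        using \<open>v \<in> ?W\<close> \<open>w \<in> ?W\<close> by blast
      have "v \<oplus>\<^bsub>?U\<^esub> w = env_coset n (f + g)"
        unfolding f(2) g(2) by (rule enveloping_algebra_simps(2)[OF n' closed[OF f(1)] closed[OF g(1)]])
      then show ?thesis using weight_ge.add[OF f(1) g(1)] by blast
    qed
    show "c \<odot>\<^bsub>?U\<^esub> v \<in> ?W" if "v \<in> ?W" for c v
    proof -
      obtain f where f: "weight_ge G n (Suc k) f" "v = env_coset n f" using \<open>v \<in> ?W\<close> by blast
      have "c \<odot>\<^bsub>?U\<^esub> v = env_coset n (Poly_Mapping.single [] c * f)"
        unfolding f(2) by (rule enveloping_algebra_simps(4)[OF n' closed[OF f(1)]])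
      then show ?thesis using weight_ge_scalar_mult[OF n' f(1)] by blast
    qed
  qed
  moreover have "weight_ge G n (length xs) (word xs)" if "set xs \<subseteq> n" for xs
    using that
  proof (induct xs)
    case Nil
    show ?case using weight_ge.scalar[of G n 1] by simp
  next
    case (Cons x xs)
    then have "weight_ge G n (1 + length xs) (word [x] * word xs)" using G by (intro weight_ge.letter) auto
    then show ?case by (simp add: word_Cons[of x xs])
  qed
  then have "{env_prod scale bracket n xs |xs. set xs \<subseteq> n \<and> length xs > k} \<subseteq> ?W"
    using weight_ge.mono[of G n _ _ "Suc k"] env_prod_word[OF n] by (clarify, metis Suc_leI)
  ultimately have "long_products_span scale bracket n k \<subseteq> ?W"
    unfolding long_products_span_def by (rule lin_span_minimal)
  with u show ?thesis by blast
qed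

section \<open>The action of the semidirect product on \<open>U(n)\<close>\<close>

lemma proj_compl_eq:
  assumes sd: "semidirect_product p n" and "z \<in> p" "x \<in> n"
  shows "proj_compl p n (z + x) = z"
  unfolding proj_compl_def
proof (rule the_equality)
  have p: "subspace p" and n: "subspace n" and pn: "p \<inter> n = {0}"
    using sd by (auto simp: semidirect_product_def lie_subalgebra_def lie_ideal_def)
  show "z \<in> p \<and> z + x - z \<in> n" using assms by simp
  fix w assume w: "w \<in> p \<and> z + x - w \<in> n"
  have "w - z \<in> p" using subspace_diff[OF p] w assms by blast
  moreover have "x - (z + x - w) \<in> n" using subspace_diff[OF n] w assms by blast
  ultimately have "w - z \<in> p \<inter> n" by simp
  then show "w = z" by (simp add: pn)
qed

lemma split_lie_algebra_semidirect:
  assumes sd: "semidirect_product p n"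
  shows "split_lie_algebra scale bracket UNIV n (proj_compl p n)"
proof -
  have p: "lie_subalgebra p" and n: "lie_ideal n" and dec: "\<And>y. \<exists>z\<in>p. \<exists>x\<in>n. y = z + x"
    using sd by (auto simp: semidirect_product_def)
  note pc = subalgebra_closed[OF p] and nc = subalgebra_closed[OF lie_ideal_subalgebra[OF n]]
  have idl: "bracket z x \<in> n" and idr: "bracket x z \<in> n" if "x \<in> n" for z x
    using n that bracket_anticommute[of x z] subspace_neg[of n] by (simp_all add: lie_ideal_def)
  have pi: "proj_compl p n (z + x) = z" if "z \<in> p" "x \<in> n" for z x by (rule proj_compl_eq[OF sd that])
  show ?thesis
  proof unfold_locales
    show "lie_subalgebra UNIV" by (simp add: lie_subalgebra_def)
    show "lie_subalgebra n" by (rule lie_ideal_subalgebra[OF n])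
    fix y obtain z x where y: "z \<in> p" "x \<in> n" "y = z + x" using dec by blast
    show "y - proj_compl p n y \<in> n" using y by (simp add: pi)
    show "proj_compl p n (scale c y) = scale c (proj_compl p n y)" for c
      using pi[of "scale c z" "scale c x"] pc(3) nc(3) y by (simp add: pi scale_right_distrib)
    fix y' obtain z' x' where y': "z' \<in> p" "x' \<in> n" "y' = z' + x'" using dec by blast
    have "y + y' = (z + z') + (x + x')" using y y' by simp
    also have "proj_compl p n \<dots> = z + z'" using y y' by (intro pi pc(2) nc(2))
    finally show "proj_compl p n (y + y') = proj_compl p n y + proj_compl p n y'" using y y' by (simp add: pi)
    \<comment> \<open>All terms except [z,z'] lie in the ideal \<open>n\<close>, so the projection
      to \<open>p\<close> is a Lie homomorphism.\<close>
    have "bracket y y' = bracket z z' + (bracket z x' + bracket x y')"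
      using y y' by (simp add: bracket_add_left bracket_add_right)
    moreover have "bracket z x' + bracket x y' \<in> n" using y y' idl idr nc(2) by blast
    ultimately show "proj_compl p n (bracket y y') = bracket (proj_compl p n y) (proj_compl p n y')"
      using pi[of "bracket z z'"] pc(4) y y' by (simp add: pi)
  qed (auto simp: idl)
qed

text \<open>Links the action on \<open>U(n)\<close> with \<open>free_action\<close>, so that the
  module axioms become the properties of \<open>free_action\<close> modulo
  \<open>env_ideal n\<close>.\<close>

lemma env_action_coset:
  assumes sd: "semidirect_product p n" and f: "f \<in> carrier (free_algebra n)"
  shows "env_action scale bracket p n y (env_coset n f) =
    env_coset n (split_lie_algebra.free_action bracket (proj_compl p n) y f)"
proof -
  interpret split_lie_algebra scale bracket UNIV n "proj_compl p n" by (rule split_lie_algebra_semidirect[OF sd])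
  have n: "lie_ideal n" using sd by (simp add: semidirect_product_def)
  note n' = lie_ideal_subalgebra[OF n]
  have D: "free_derivation bracket z f \<in> carrier (free_algebra n)" for z
    using n f by (intro free_derivation_closed) (auto simp: lie_ideal_def)
  have w: "word [y - proj_compl p n y] \<in> carrier (free_algebra n)"
    using diff_in by (intro single_free_algebra) auto
  show ?thesis
    unfolding env_action_def Let_def env_derivation_coset[OF n f] env_incl_def free_action_def
      enveloping_algebra_simps(3)[OF n' w f] enveloping_algebra_simps(2)[OF n' D mult_free_algebra[OF w f]] ..
qed

lemma lie_module_enveloping_algebra:
  assumes sd: "semidirect_product p n"
  shows "lie_module scale bracket (enveloping_algebra scale bracket n) (env_action scale bracket p n)"
proof -
  interpret split_lie_algebra scale bracket UNIV n "proj_compl p n" by (rule split_lie_algebra_semidirect[OF sd])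
  let ?U = "enveloping_algebra scale bracket n" and ?F = "free_algebra n"
  interpret U: Module.module complex_field ?U by (rule module_enveloping_algebra[OF m])
  note simps = enveloping_algebra_simps[OF m] env_action_coset[OF sd] free_action_closed[OF UNIV_I]
  have sc: "Poly_Mapping.single [] c * f \<in> carrier ?F" if "f \<in> carrier ?F" for c f
    using that by (intro mult_free_algebra single_free_algebra) auto
  have minus: "env_coset n f \<ominus>\<^bsub>?U\<^esub> env_coset n g = env_coset n (f - g)"
    if "f \<in> carrier ?F" "g \<in> carrier ?F" for f g
  proof -
    have "\<ominus>\<^bsub>?U\<^esub> env_coset n g = env_coset n (- g)"
      using that by (intro U.M.minus_equality) (auto simp: simps minus_free_algebra)
    then show ?thesis using that by (simp add: a_minus_def simps minus_free_algebra)
  qed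
  show ?thesis
    unfolding lie_module_def
  proof (intro conjI allI ballI)
    show "lie_algebra scale bracket" ..
    show "Module.module complex_field ?U" ..
    fix v assume "v \<in> carrier ?U"
    then obtain f where f: "f \<in> carrier ?F" and v: "v = env_coset n f" by (auto simp: simps)
    fix x
    show "env_action scale bracket p n x v \<in> carrier ?U" by (simp add: v simps f)
    show "env_action scale bracket p n x (c \<odot>\<^bsub>?U\<^esub> v) = c \<odot>\<^bsub>?U\<^esub> env_action scale bracket p n x v" for c
      by (simp add: v simps f sc free_action_scalar)
    show "env_action scale bracket p n (scale c x) v = c \<odot>\<^bsub>?U\<^esub> env_action scale bracket p n x v" for c
      using free_action_scale[OF UNIV_I f] by (simp add: v simps f sc env_coset_eq_iff[OF m])
    fix y
    show "env_action scale bracket p n (x + y) v =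
        env_action scale bracket p n x v \<oplus>\<^bsub>?U\<^esub> env_action scale bracket p n y v"
      using free_action_plus[OF UNIV_I UNIV_I f]
      by (simp add: v simps f add_free_algebra env_coset_eq_iff[OF m] diff_diff_eq)
    show "env_action scale bracket p n (bracket x y) v =
        env_action scale bracket p n x (env_action scale bracket p n y v) \<ominus>\<^bsub>?U\<^esub>
        env_action scale bracket p n y (env_action scale bracket p n x v)"
      using free_action_bracket[OF UNIV_I UNIV_I f]
      by (simp add: v simps f diff_free_algebra env_coset_eq_iff[OF m] minus)
  next
    fix x v w assume "v \<in> carrier ?U" "w \<in> carrier ?U"
    then obtain f g where "f \<in> carrier ?F" "v = env_coset n f" "g \<in> carrier ?F" "w = env_coset n g"
      by (auto simp: simps)
    then show "env_action scale bracket p n x (v \<oplus>\<^bsub>?U\<^esub> w) =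
        env_action scale bracket p n x v \<oplus>\<^bsub>?U\<^esub> env_action scale bracket p n x w"
      by (simp add: simps add_free_algebra free_action_add)
  qed
qed

text \<open>The derivation part keeps the number of factors of a product, and left multiplication
  raises it by one. Products suffice, since the elements sent into the span by the whole Lie algebra
  form a subspace.\<close>

lemma long_products_span_lie_submodule:
  assumes sd: "semidirect_product p n"
  shows "lie_submodule scale bracket (enveloping_algebra scale bracket n) (env_action scale bracket p n)
    (long_products_span scale bracket n k)"
proof -
  interpret split_lie_algebra scale bracket UNIV n "proj_compl p n" by (rule split_lie_algebra_semidirect[OF sd])
  let ?U = "enveloping_algebra scale bracket n" and ?I = "long_products_span scale bracket n k"
    and ?act = "env_action scale bracket p n"
  have n: "lie_ideal n" using sd by (simp add: semidirect_product_def)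
  note U = module_enveloping_algebra[OF m] and I = long_products_span_submodule[OF n, of k]
  note act = lie_module_enveloping_algebra[OF sd]
  note subI = submoduleD[OF U I]
  have zero: "?act y \<zero>\<^bsub>?U\<^esub> = \<zero>\<^bsub>?U\<^esub>" for y
    by (simp add: enveloping_algebra_simps(5)[OF m] env_action_coset[OF sd] zero_free_algebra)
  have "submodule {u \<in> carrier ?U. \<forall>y. ?act y u \<in> ?I} complex_field ?U"
  proof (rule complex_submoduleI[OF U])
    interpret U: Module.module complex_field ?U by (rule U)
    show "\<zero>\<^bsub>?U\<^esub> \<in> {u \<in> carrier ?U. \<forall>y. ?act y u \<in> ?I}" using zero subI(2) by auto
  qed (use act subI submoduleD(3,4)[OF U submodule_carrier[OF U]] in \<open>auto simp: lie_module_def\<close>)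
  moreover have "env_prod scale bracket n xs \<in> {u \<in> carrier ?U. \<forall>y. ?act y u \<in> ?I}"
    if xs: "set xs \<subseteq> n" "length xs > k" for xs
  proof -
    have wxs: "word xs \<in> carrier (free_algebra n)" by (rule single_free_algebra[OF xs(1)])
    have "env_coset n (free_action y (word xs)) \<in> ?I" for y
    proof -
      have upd: "set (xs[i := bracket z (xs ! i)]) \<subseteq> n" if "i < length xs" for i z
      proof -
        have "bracket z (xs ! i) \<in> n" using n xs(1) nth_mem[OF that] by (simp add: lie_ideal_def subsetD)
        with xs(1) show ?thesis using set_update_subset_insert[of xs i] by blast
      qed
      \<comment> \<open>The sum from the Leibniz rule is built up term by term; membership in the
        carrier is carried along so that cosets can be added by representatives.\<close>
      have sum: "(\<Sum>i<l. word (xs[i := bracket z (xs ! i)])) \<in> carrier (free_algebra n) \<and>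
          env_coset n (\<Sum>i<l. word (xs[i := bracket z (xs ! i)])) \<in> ?I" if "l \<le> length xs" for l z
        using that
      proof (induct l)
        case 0
        then show ?case using subI(2) by (simp add: zero_free_algebra enveloping_algebra_simps(5)[OF m])
      next
        case (Suc l)
        let ?w = "word (xs[l := bracket z (xs ! l)])"
        have "set (xs[l := bracket z (xs ! l)]) \<subseteq> n" using Suc by (intro upd) simp
        then have "?w \<in> carrier (free_algebra n)" "env_coset n ?w \<in> ?I"
          using xs by (auto intro: single_free_algebra word_in_long_products_span[OF n])
        with Suc subI(3)[of "env_coset n (\<Sum>i<l. word (xs[i := bracket z (xs ! i)]))" "env_coset n ?w"]
        show ?case by (simp add: add_free_algebra enveloping_algebra_simps(2)[OF m])
      qed
      let ?z = "proj_compl p n y"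
      have x: "set ((y - ?z) # xs) \<subseteq> n" using diff_in xs by auto
      then have "env_coset n (word ((y - ?z) # xs)) \<in> ?I" using xs by (intro word_in_long_products_span[OF n]) auto
      with sum[of "length xs" ?z] subI(3) single_free_algebra[OF x, of 1]
      show ?thesis
        by (simp add: free_action_def free_derivation_single word_Cons[of "y - ?z" xs, symmetric]
            enveloping_algebra_simps(2)[OF m, symmetric])
    qed
    with wxs show ?thesis
      by (simp add: env_prod_word[OF n xs(1)] env_action_coset[OF sd] enveloping_algebra_simps(1)[OF m])
  qed
  then have "{env_prod scale bracket n xs |xs. set xs \<subseteq> n \<and> length xs > k} \<subseteq> {u \<in> carrier ?U. \<forall>y. ?act y u \<in> ?I}"
    by blast
  ultimately have "?I \<subseteq> {u \<in> carrier ?U. \<forall>y. ?act y u \<in> ?I}"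
    unfolding long_products_span_def[of scale bracket n k] by (rule lin_span_minimal)
  with act I show ?thesis by (auto simp: lie_submodule_def)
qed

text \<open>Multilinearity of the product reduces all words to words over \<open>B\<close>. Those of
  length at most \<open>k\<close> are finitely many, and the longer ones vanish in the
  quotient.\<close>

lemma fin_dim_quotient_long_products:
  assumes n: "lie_ideal n" and B: "finite B" "B \<subseteq> n" "n \<subseteq> span B"
  shows "fin_dim (quotient_space (enveloping_algebra scale bracket n) (long_products_span scale bracket n k))"
proof -
  let ?U = "enveloping_algebra scale bracket n" and ?I = "long_products_span scale bracket n k" and ?F = "free_algebra n"
  let ?Q = "quotient_space ?U ?I"
  note n' = lie_ideal_subalgebra[OF n]
  note U = module_enveloping_algebra[OF n'] and I = long_products_span_submodule[OF n, of k]
  note Qs = quotient_space_simps[OF U I] and Us = enveloping_algebra_simps[OF n']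
  have Q: "Module.module complex_field ?Q" by (rule quotient_space_module[OF U I])
  define q where "q f = ?I +>\<^bsub>?U\<^esub> env_coset n f" for f
  have q_carrier: "carrier ?Q = q ` carrier ?F" by (auto simp: Qs(1) Us(1) q_def)
  have q_add: "q f \<oplus>\<^bsub>?Q\<^esub> q g = q (f + g)" if "f \<in> carrier ?F" "g \<in> carrier ?F" for f g
    using that by (simp add: q_def Qs(2) Us(1,2))
  have q_smult: "c \<odot>\<^bsub>?Q\<^esub> q f = q (Poly_Mapping.single [] c * f)" if "f \<in> carrier ?F" for c f
    using that by (simp add: q_def Qs(3) Us(1,4))
  have q_zero: "\<zero>\<^bsub>?Q\<^esub> = q 0" by (simp add: q_def Qs(4) Us(5))
  have q_cong: "q f = q g" if "f \<in> carrier ?F" "g \<in> carrier ?F" "f - g \<in> env_ideal n" for f g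
    using env_coset_eq_iff[OF n' that(1,2)] that(3) by (simp add: q_def)
  have q_long: "q (word xs) = \<zero>\<^bsub>?Q\<^esub>" if "set xs \<subseteq> n" "length xs > k" for xs
  proof -
    interpret abelian_subgroup ?I ?U by (rule submodule_abelian_subgroup[OF U I])
    show ?thesis using a_rcos_const[OF word_in_long_products_span[OF n that]] by (simp add: q_def quotient_space_def)
  qed
  define S where "S = (\<lambda>xs. q (word xs)) ` {xs. set xs \<subseteq> B \<and> length xs \<le> k}"
  have S: "finite S" "S \<subseteq> carrier ?Q"
    using finite_lists_length_le[OF B(1)] B(2) by (auto simp: S_def q_carrier intro!: imageI single_free_algebra)
  have "carrier ?Q \<subseteq> X" if X: "submodule X complex_field ?Q" and SX: "S \<subseteq> X" for X
  proof -
    note subX = submoduleD[OF Q X]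
    have add: "q (f + g) \<in> X" if "f \<in> carrier ?F" "g \<in> carrier ?F" "q f \<in> X" "q g \<in> X" for f g
      using subX(3)[OF that(3,4)] that by (simp add: q_add)
    have smult: "q (Poly_Mapping.single [] c * f) \<in> X" if "f \<in> carrier ?F" "q f \<in> X" for f c
      using subX(4)[OF that(2)] that by (simp add: q_smult)
    \<comment> \<open>The prefix \<open>bs\<close> holds the letters already expanded in
      \<open>B\<close>, and \<open>xs\<close> those letters of \<open>n\<close> still to be
      treated.\<close>
    have word_X: "q (word (bs @ xs)) \<in> X" if "set bs \<subseteq> B" "set xs \<subseteq> n" for bs xs
      using that
    proof (induct xs arbitrary: bs)
      case Nil
      then show ?case using SX subX(2) q_long[of bs] B(2) by (cases "length bs \<le> k") (auto simp: S_def)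
    next
      case (Cons x xs)
      let ?w = "\<lambda>x. word (bs @ x # xs)"
      have bs: "set bs \<subseteq> n" and xs: "set xs \<subseteq> n" using Cons B by auto
      have w: "?w x = word bs * (word [x] * word xs)" for x by (simp add: mult_single plus_list_def)
      have wF: "?w x \<in> carrier ?F" if "x \<in> n" for x using that bs xs by (intro single_free_algebra) auto
      \<comment> \<open>With the other letters fixed, the class is linear in the letter
        \<open>x\<close>, so the letters whose word lands in \<open>X\<close> form a subspace; it
        contains \<open>B\<close> by the induction hypothesis.\<close>
      have "span B \<subseteq> {x \<in> n. q (?w x) \<in> X}"
      proof (rule span_minimal)
        show "B \<subseteq> {x \<in> n. q (?w x) \<in> X}" using Cons(1)[of "bs @ [_]"] Cons(2,3) B(2) by auto
        have in_J: "word bs * (f * word xs) \<in> env_ideal n" if "f \<in> env_ideal n" for f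
          using that bs xs by (intro env_ideal_closed(6,7)[OF n'] single_free_algebra)
        have plus: "q (?w (x + y)) \<in> X" if "x \<in> n" "y \<in> n" "q (?w x) \<in> X" "q (?w y) \<in> X" for x y
        proof -
          have "?w (x + y) - (?w x + ?w y) = word bs * ((word [x + y] - word [x] - word [y]) * word xs)"
            unfolding w by (simp only: algebra_simps)
          then have "?w (x + y) - (?w x + ?w y) \<in> env_ideal n"
            using in_J[OF env_ideal_relations(1)[OF n' that(1,2)]] by (simp only:)
          then have "q (?w (x + y)) = q (?w x + ?w y)"
            using that subalgebra_closed(2)[OF n'] by (intro q_cong add_free_algebra wF)
          then show ?thesis using add[OF wF wF] that by simp
        qed
        have scal: "q (?w (scale c x)) \<in> X" if "x \<in> n" "q (?w x) \<in> X" for x c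
        proof -
          have "Poly_Mapping.single [] c * ?w x = word bs * (Poly_Mapping.single [x] c * word xs)"
            by (simp add: mult_single plus_list_def)
          then have "?w (scale c x) - Poly_Mapping.single [] c * ?w x =
              word bs * ((word [scale c x] - Poly_Mapping.single [x] c) * word xs)"
            unfolding w by (simp only: right_diff_distrib left_diff_distrib)
          then have "?w (scale c x) - Poly_Mapping.single [] c * ?w x \<in> env_ideal n"
            using in_J[OF env_ideal_relations(2)[OF n' that(1)]] by (simp only:)
          then have "q (?w (scale c x)) = q (Poly_Mapping.single [] c * ?w x)"
            using that subalgebra_closed(3)[OF n'] by (intro q_cong mult_free_algebra wF single_free_algebra) auto
          then show ?thesis using smult[OF wF] that by simp
        qed
        have "?w 0 - 0 \<in> env_ideal n" using in_J[OF word_zero_env_ideal[OF n']] unfolding w by simp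
        then have "q (?w 0) = q 0" using subalgebra_closed(1)[OF n'] by (intro q_cong wF zero_free_algebra)
        then have "q (?w 0) \<in> X" using subX(2) q_zero by simp
        then show "subspace {x \<in> n. q (?w x) \<in> X}"
          using plus scal subalgebra_closed[OF n'] by (auto simp: subspace_def)
      qed
      then show ?case using Cons(3) B(3) by auto
    qed
    \<comment> \<open>The prefix \<open>ys\<close> collects the letters split off from
      \<open>f\<close> on the left.\<close>
    have "q (word ys * f) \<in> X" if "f \<in> carrier ?F" "set ys \<subseteq> n" for f ys
      using that
    proof (induct f arbitrary: ys rule: free_algebra_induct)
      case (scalar c)
      have "word ys * Poly_Mapping.single [] c = Poly_Mapping.single [] c * word ys" by (simp add: mult.commute)
      then show ?case using smult[of "word ys" c] word_X[of "[]" ys] scalar by (simp add: single_free_algebra)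
    next
      case (letter x f)
      have "word ys * (word [x] * f) = word (ys @ [x]) * f"
        by (simp add: mult.assoc[symmetric]) (simp add: mult_single plus_list_def)
      then show ?case using letter by simp
    next
      case (add f g)
      then show ?case using \<open>\<And>f g. f \<in> carrier ?F \<Longrightarrow> g \<in> carrier ?F \<Longrightarrow> q f \<in> X \<Longrightarrow> q g \<in> X \<Longrightarrow> q (f + g) \<in> X\<close>
        by (simp add: distrib_left mult_free_algebra single_free_algebra)
    qed
    from this[of _ "[]"] show ?thesis by (auto simp: q_carrier)
  qed
  then have "carrier ?Q \<subseteq> lin_span ?Q S" by (auto simp: lin_span_def)
  moreover have "lin_span ?Q S \<subseteq> carrier ?Q" by (rule lin_span_minimal[OF submodule_carrier[OF Q] S(2)])
  ultimately show ?thesis unfolding fin_dim_def using S by blast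
qed

text \<open>An element of the span has a representative of weight at least \<open>Suc l\<close>,
  hence so does the letter \<open>x\<close>, and \<open>weight_ge_letter_eq_0\<close> applies to the
  lower central series.\<close>

lemma letter_in_long_products_span:
  assumes fd: "finite_dimensional_vector_space scale B" and n: "lie_ideal n"
    and vanish: "lower_central_series n (k - 1) = {0}" and "k \<le> Suc l"
    and x: "x \<in> n" and I: "env_coset n (word [x]) \<in> long_products_span scale bracket n l"
  shows "x = 0"
proof -
  note n' = lie_ideal_subalgebra[OF n]
  \<comment> \<open>The shift by one gives the letters of \<open>n\<close> weight 1, with
    \<open>?G 0\<close> and \<open>?G 1\<close> both equal to \<open>n\<close>, and makes
    \<open>?G k\<close> the term that vanishes.\<close>
  let ?G = "\<lambda>i. lower_central_series n (i - 1)"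
  have dec: "?G j \<subseteq> ?G i" if "i \<le> j" for i j using that by (intro lower_central_series_decreasing[OF n']) simp
  have "n \<subseteq> ?G 1" by simp
  from long_products_span_weight[where G = ?G, OF n this I] obtain f where f: "weight_ge ?G n (Suc l) f" "env_coset n (word [x]) = env_coset n f"
    by blast
  have "word [x] - f \<in> env_ideal n"
    using f(2) env_coset_eq_iff[OF n' _ weight_ge_closed[OF n' f(1)]] x by (simp add: single_free_algebra)
  from weight_ge.add[OF weight_ge.ideal[OF this] f(1)] have "weight_ge ?G n (Suc l) (word [x])" by simp
  then have "weight_ge ?G n k (word [x])" using \<open>k \<le> Suc l\<close> by (rule weight_ge.mono)
  then show ?thesis
  proof (rule weight_ge_letter_eq_0[OF fd, where G = ?G and j = k and n = n, rotated -1])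
    \<comment> \<open>For positive i and j the indices match exactly; when one of them is 0 the
      bracket lies deeper than required.\<close>
    show "bracket x y \<in> ?G (i + j)" if "x \<in> ?G i" "y \<in> ?G j" for x y i j
      by (rule subsetD[OF lower_central_series_decreasing[OF n'] lower_central_series_bracket[OF n' that]]) simp
  qed (use n' x vanish dec in \<open>auto intro: lower_central_series_subspace\<close>)
qed

end

section \<open>Finite dimension and faithfulness of the quotient\<close>

theorem mainTheorem1:
  fixes scale :: "complex \<Rightarrow> 'g::ab_group_add \<Rightarrow> 'g"
    and bracket :: "'g \<Rightarrow> 'g \<Rightarrow> 'g"
    and p n :: "'g set"
    and k :: nat
  assumes "lie_algebra scale bracket"
    and "\<exists>B. finite_dimensional_vector_space scale B"
    and "lie_algebra.semidirect_product scale bracket p n"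
    and "lie_algebra.lie_nilpotent scale bracket n"
    and "\<forall>z\<in>p. z \<noteq> 0 \<longrightarrow> (\<exists>x\<in>n. bracket z x \<noteq> 0)"
    and "k = (LEAST m. 0 < m \<and>
      (\<forall>xs. length xs = m \<and> set xs \<subseteq> n \<longrightarrow> left_commutator bracket xs = 0))"
  defines "U \<equiv> enveloping_algebra scale bracket n"
    and "act \<equiv> env_action scale bracket p n"
    and "I \<equiv> long_products_span scale bracket n (k + 2)"
  shows "lie_submodule scale bracket U act I \<and>
    lie_module scale bracket (quotient_space U I) (\<lambda>x. coset_map U I (act x)) \<and>
    fin_dim (quotient_space U I) \<and>
    faithful_action (quotient_space U I) (\<lambda>x. coset_map U I (act x))"
proof -
  interpret lie_algebra scale bracket by fact
  obtain B where fd: "finite_dimensional_vector_space scale B" using assms(2) by blast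
  interpret fd: finite_dimensional_vector_space scale B by (rule fd)
  note sd = assms(3)
  interpret split_lie_algebra scale bracket UNIV n "proj_compl p n" by (rule split_lie_algebra_semidirect[OF sd])
  have n: "lie_ideal n" using sd by (simp add: semidirect_product_def)
  note n' = lie_ideal_subalgebra[OF n]
  have I: "lie_submodule scale bracket U act I"
    unfolding U_def act_def I_def by (rule long_products_span_lie_submodule[OF sd])
  have U: "Module.module complex_field U" "submodule I complex_field U"
    using I by (auto simp: lie_submodule_def lie_module_def)
  have "subspace n" using n by (simp add: lie_ideal_def)
  then obtain C where C: "finite C" "C \<subseteq> n" "span C = n"
    using fd.basis_subspace_exists by metis
  have fin: "fin_dim (quotient_space U I)"
    unfolding U_def I_def using C by (intro fin_dim_quotient_long_products[OF n, of C]) auto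
  \<comment> \<open>\<open>n\<close> meets \<open>I\<close> only in 0; here \<open>l\<close> is
    \<open>k + 2\<close>.\<close>
  have letter: "x = 0" if "x \<in> n" "env_coset n (word [x]) \<in> I" for x
    by (rule letter_in_long_products_span[OF fd n lower_central_series_vanishes[OF n' assms(4,6)] _
        that(1) that(2)[unfolded I_def]]) simp
  have "y = 0" if y: "\<And>v. v \<in> carrier (quotient_space U I) \<Longrightarrow> coset_map U I (act y) v = \<zero>\<^bsub>quotient_space U I\<^esub>" for y
  proof -
    interpret W: abelian_subgroup I U by (rule submodule_abelian_subgroup[OF U])
    have kill: "env_coset n (free_action y f) \<in> I" if f: "f \<in> carrier (free_algebra n)" for f
    proof -
      have u: "env_coset n f \<in> carrier U" "env_coset n (free_action y f) \<in> carrier U"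
        using f free_action_closed by (auto simp: U_def enveloping_algebra_simps(1)[OF n'])
      have "I +>\<^bsub>U\<^esub> env_coset n (free_action y f) = I"
        using y[of "I +>\<^bsub>U\<^esub> env_coset n f"] u(1) coset_map_lie_action[OF I u(1), of y]
        by (simp add: quotient_space_simps(1)[OF U] act_def env_action_coset[OF sd f]) (simp add: quotient_space_def)
      then show ?thesis using W.a_coset_join1 u(2) W.a_subgroup by blast
    qed
    let ?z = "proj_compl p n y"
    have "env_coset n (word [y - ?z]) \<in> I"
      using kill[of 1] single_free_algebra[of "[]" n 1]
      by (simp add: free_action_def free_derivation_Nil[where c = 1, simplified])
    then have yz: "y - ?z = 0" using letter diff_in by blast
    have "bracket ?z x = 0" if x: "x \<in> n" for x
    proof (rule letter)
      show "bracket ?z x \<in> n" using x by (rule bracket_in[OF UNIV_I])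
      have wx: "word [x] \<in> carrier (free_algebra n)" using x by (simp add: single_free_algebra)
      \<comment> \<open>As \<open>y\<close> equals \<open>?z\<close>, the left multiplication is by
        the letter 0, which is nonzero in the free algebra but lies in
        \<open>env_ideal n\<close>.\<close>
      have "free_action y (word [x]) - word [bracket ?z x] = word [0] * word [x]"
        by (simp add: free_action_def yz)
      then have "free_action y (word [x]) - word [bracket ?z x] \<in> env_ideal n"
        using env_ideal_closed(7)[OF n' word_zero_env_ideal[OF n'] wx] by simp
      then have "env_coset n (free_action y (word [x])) = env_coset n (word [bracket ?z x])"
        using env_coset_eq_iff[OF n' free_action_closed[OF UNIV_I wx]] bracket_in[OF UNIV_I x]
        by (simp add: single_free_algebra)
      with kill[OF wx] show "env_coset n (word [bracket ?z x]) \<in> I" by simp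
    qed
    moreover have "?z \<in> p"
    proof -
      obtain z x where "z \<in> p" "x \<in> n" "y = z + x" using sd unfolding semidirect_product_def by blast
      then show ?thesis using proj_compl_eq[OF sd] by simp
    qed
    ultimately have "?z = 0" using assms(5) by blast
    with yz show ?thesis by simp
  qed
  then have "faithful_action (quotient_space U I) (\<lambda>x. coset_map U I (act x))"
    by (auto simp: faithful_action_def)
  with I fin lie_module_quotient[OF I] show ?thesis by blast
qed

end
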